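(* Let $A$ and $B$ be $\sigma$-unital $\mathbb{Z}_2$-graded $C^*$-algebras. The direct sum of unbounded $A$-$B$-cycles is well-defined, i.e. if $(\pi_0,E_0,\mathcal{D}_0)$ and $(\pi_1,E_1,\mathcal{D}_1)$ are unbounded $A$-$B$-cycles then so is $(\pi_0\oplus\pi_1,E_0\oplus E_1,\mathcal{D}_0\oplus\mathcal{D}_1)$; therefore the set $\overline{\Psi}_1(A,B)$ of unbounded $A$-$B$-cycles is a semigroup.
   Context: Conventions: $[a,b]$ denotes the graded commutator. Hilbert modules are $\mathbb{Z}_2$-graded and countably generated; $\mathrm{End}_B^*(E)$ and $\mathrm{End}_B^0(E)$ denote the adjointable and the compact operators on $E$; $\overline{W}$ is the operator-norm closure of $W\subset\mathrm{End}_B^*(E)$. For a regular self-adjoint operator $\mathcal{D}$ on $E$, let $\mathrm{Lip}(\mathcal{D})$ be the set of $T\in\mathrm{End}_B^*(E)$ with $T(\mathrm{Dom}\,\mathcal{D})\subset\mathrm{Dom}\,\mathcal{D}$ and such that $[\mathcal{D},T]$ is (extends to) an element of $\mathrm{End}_B^*(E)$, and let $\mathrm{Lip}^0(\mathcal{D}):=\{T\in\mathrm{Lip}(\mathcal{D}) : T(1+\mathcal{D}^2)^{-1/2},\,T^*(1+\mathcal{D}^2)^{-1/2}\in\mathrm{End}_B^0(E)\}$. An unbounded $A$-$B$-cycle $(\pi,E,\mathcal{D})$ consists of a $\mathbb{Z}_2$-graded countably generated Hilbert $B$-module $E$, a $\mathbb{Z}_2$-graded $*$-homomorphism $\pi\colon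 A\to\mathrm{End}_B^*(E)$, and an odd regular self-adjoint operator $\mathcal{D}$ on $E$ such that $\pi(A)\subset\overline{\mathrm{Lip}^0(\mathcal{D})}$. *)

theory Defs
  imports "HOL-Analysis.Analysis" "HOL-Algebra.Module"
begin

section \<open>C*-algebras\<close>

class cstar_algebra = real_normed_algebra + banach +
  fixes scaleC :: "complex \<Rightarrow> 'a \<Rightarrow> 'a"  (infixr "*\<^sub>C" 75)
    and star :: "'a \<Rightarrow> 'a"
  assumes scaleC_of_real: "complex_of_real r *\<^sub>C x = r *\<^sub>R x"
    and scaleC_add_right: "c *\<^sub>C (x + y) = c *\<^sub>C x + c *\<^sub>C y"
    and scaleC_add_left: "(c + d) *\<^sub>C x = c *\<^sub>C x + d *\<^sub>C x"
    and scaleC_scaleC: "c *\<^sub>C d *\<^sub>C x = (c * d) *\<^sub>C x"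
    and mult_scaleC_left: "(c *\<^sub>C x) * y = c *\<^sub>C (x * y)"
    and mult_scaleC_right: "x * (c *\<^sub>C y) = c *\<^sub>C (x * y)"
    and norm_scaleC: "norm (c *\<^sub>C x) = cmod c * norm x"
    and star_star: "star (star x) = x"
    and star_add: "star (x + y) = star x + star y"
    and star_scaleC: "star (c *\<^sub>C x) = cnj c *\<^sub>C star x"
    and star_mult: "star (x * y) = star y * star x"
    and cstar_identity: "norm (star x * x) = (norm x)\<^sup>2"

text \<open>The grading is encoded by its grading automorphism, which is \<open>1\<close> on the even part and
  \<open>-1\<close> on the odd part.\<close>

class graded_cstar_algebra = cstar_algebra +
  fixes grading :: "'a \<Rightarrow> 'a"
  assumes grading_grading: "grading (grading x) = x"
    and grading_add: "grading (x + y) = grading x + grading y"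
    and grading_scaleC: "grading (c *\<^sub>C x) = c *\<^sub>C grading x"
    and grading_mult: "grading (x * y) = grading x * grading y"
    and grading_star: "grading (star x) = star (grading x)"

text \<open>The algebras need not be unital, so the spectrum is taken in the unitization: \<open>1 - x\<close> is
  invertible there, with inverse \<open>1 - y\<close>, iff \<open>x + y = x * y = y * x\<close>, and for \<open>z \<noteq> 0\<close> the
  element \<open>z - x\<close> is invertible iff \<open>1 - x / z\<close> is.  Whether \<open>0\<close> is a spectral value does not
  matter for positivity.\<close>

definition quasi_invertible :: "'a::cstar_algebra \<Rightarrow> bool"
  where "quasi_invertible x \<longleftrightarrow> (\<exists>y. x + y = x * y \<and> x + y = y * x)"

definition nonzero_spectrum :: "'a::cstar_algebra \<Rightarrow> complex set"
  where "nonzero_spectrum x = {z. z \<noteq> 0 \<and> \<not> quasi_invertible (inverse z *\<^sub>C x)}"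

definition positive :: "'a::cstar_algebra \<Rightarrow> bool"
  where "positive x \<longleftrightarrow> star x = x \<and> nonzero_spectrum x \<subseteq> \<real>\<^sub>\<ge>\<^sub>0"

definition sigma_unital :: "'a::cstar_algebra itself \<Rightarrow> bool"
  where "sigma_unital _ \<longleftrightarrow>
    (\<exists>u :: nat \<Rightarrow> 'a. (\<forall>n. positive (u n) \<and> norm (u n) \<le> 1) \<and>
      (\<forall>a. (\<lambda>n. u n * a) \<longlonglongrightarrow> a \<and> (\<lambda>n. a * u n) \<longlonglongrightarrow> a))"


section \<open>Graded Hilbert C*-modules\<close>

text \<open>The underlying complex vector space is a module in the sense of HOL-Algebra; the
  multiplicative fields \<open>mult\<close> and \<open>one\<close> inherited from the ring record are never used.
  The inner product is conjugate linear in the first argument.\<close>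

record ('b, 'e) hilbert_module = "(complex, 'e) module" +
  act :: "'e \<Rightarrow> 'b \<Rightarrow> 'e"
  hinner :: "'e \<Rightarrow> 'e \<Rightarrow> 'b"
  hgrade :: "'e \<Rightarrow> 'e"

definition complex_ring :: "complex ring"
  where "complex_ring = \<lparr>carrier = UNIV, mult = (*), one = 1, zero = 0, add = (+)\<rparr>"

definition hnorm :: "('b::cstar_algebra, 'e) hilbert_module \<Rightarrow> 'e \<Rightarrow> real"
  where "hnorm E x = sqrt (norm (hinner E x x))"

definition hconverges :: "('b::cstar_algebra, 'e) hilbert_module \<Rightarrow> (nat \<Rightarrow> 'e) \<Rightarrow> 'e \<Rightarrow> bool"
  where "hconverges E X x \<longleftrightarrow> (\<lambda>n. hnorm E (X n \<ominus>\<^bsub>E\<^esub> x)) \<longlonglongrightarrow> 0"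

definition hCauchy :: "('b::cstar_algebra, 'e) hilbert_module \<Rightarrow> (nat \<Rightarrow> 'e) \<Rightarrow> bool"
  where "hCauchy E X \<longleftrightarrow>
    (\<forall>\<epsilon>>0. \<exists>N. \<forall>m\<ge>N. \<forall>n\<ge>N. hnorm E (X m \<ominus>\<^bsub>E\<^esub> X n) < \<epsilon>)"

definition hdense :: "('b::cstar_algebra, 'e) hilbert_module \<Rightarrow> 'e set \<Rightarrow> bool"
  where "hdense E S \<longleftrightarrow> S \<subseteq> carrier E \<and>
    (\<forall>x\<in>carrier E. \<forall>\<epsilon>>0. \<exists>s\<in>S. hnorm E (x \<ominus>\<^bsub>E\<^esub> s) < \<epsilon>)"

definition pre_hilbert_module :: "('b::cstar_algebra, 'e) hilbert_module \<Rightarrow> bool"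
  where "pre_hilbert_module E \<longleftrightarrow>
    module complex_ring E \<and>
    (\<forall>x\<in>carrier E. \<forall>b. act E x b \<in> carrier E) \<and>
    (\<forall>x\<in>carrier E. \<forall>y\<in>carrier E. \<forall>b. act E (x \<oplus>\<^bsub>E\<^esub> y) b = act E x b \<oplus>\<^bsub>E\<^esub> act E y b) \<and>
    (\<forall>x\<in>carrier E. \<forall>b c. act E x (b + c) = act E x b \<oplus>\<^bsub>E\<^esub> act E x c) \<and>
    (\<forall>x\<in>carrier E. \<forall>b c. act E x (b * c) = act E (act E x b) c) \<and>
    (\<forall>x\<in>carrier E. \<forall>b c. act E (c \<odot>\<^bsub>E\<^esub> x) b = c \<odot>\<^bsub>E\<^esub> act E x b \<and>
                           act E x (c *\<^sub>C b) = c \<odot>\<^bsub>E\<^esub> act E x b) \<and>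
    (\<forall>x\<in>carrier E. \<forall>y\<in>carrier E. \<forall>z\<in>carrier E.
       hinner E x (y \<oplus>\<^bsub>E\<^esub> z) = hinner E x y + hinner E x z) \<and>
    (\<forall>x\<in>carrier E. \<forall>y\<in>carrier E. \<forall>c. hinner E x (c \<odot>\<^bsub>E\<^esub> y) = c *\<^sub>C hinner E x y) \<and>
    (\<forall>x\<in>carrier E. \<forall>y\<in>carrier E. \<forall>b. hinner E x (act E y b) = hinner E x y * b) \<and>
    (\<forall>x\<in>carrier E. \<forall>y\<in>carrier E. star (hinner E x y) = hinner E y x) \<and>
    (\<forall>x\<in>carrier E. positive (hinner E x x)) \<and>
    (\<forall>x\<in>carrier E. hinner E x x = 0 \<longrightarrow> x = \<zero>\<^bsub>E\<^esub>)"

definition hilbert_module :: "('b::cstar_algebra, 'e) hilbert_module \<Rightarrow> bool"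
  where "hilbert_module E \<longleftrightarrow> pre_hilbert_module E \<and>
    (\<forall>X. (\<forall>n. X n \<in> carrier E) \<and> hCauchy E X \<longrightarrow> (\<exists>x\<in>carrier E. hconverges E X x))"

definition countably_generated :: "('b::cstar_algebra, 'e) hilbert_module \<Rightarrow> bool"
  where "countably_generated E \<longleftrightarrow>
    (\<exists>G\<subseteq>carrier E. countable G \<and>
      hdense E {(\<Oplus>\<^bsub>E\<^esub>i\<in>{..<n}. act E (g i) (b i)) | (n::nat) g b. \<forall>i<n. g i \<in> G})"

text \<open>For a non-trivially graded algebra the grading operator is not linear over the algebra.\<close>

definition graded_hilbert_module :: "('b::graded_cstar_algebra, 'e) hilbert_module \<Rightarrow> bool"
  where "graded_hilbert_module E \<longleftrightarrow> hilbert_module E \<and>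
    (\<forall>x\<in>carrier E. hgrade E x \<in> carrier E \<and> hgrade E (hgrade E x) = x) \<and>
    (\<forall>x\<in>carrier E. \<forall>y\<in>carrier E. hgrade E (x \<oplus>\<^bsub>E\<^esub> y) = hgrade E x \<oplus>\<^bsub>E\<^esub> hgrade E y) \<and>
    (\<forall>x\<in>carrier E. \<forall>c. hgrade E (c \<odot>\<^bsub>E\<^esub> x) = c \<odot>\<^bsub>E\<^esub> hgrade E x) \<and>
    (\<forall>x\<in>carrier E. \<forall>b. hgrade E (act E x b) = act E (hgrade E x) (grading b)) \<and>
    (\<forall>x\<in>carrier E. \<forall>y\<in>carrier E. hinner E (hgrade E x) (hgrade E y) = grading (hinner E x y))"


section \<open>Adjointable and compact operators\<close>

text \<open>Operators on \<open>E\<close> are functions on the ambient type of which only the restriction to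
  \<open>carrier E\<close> is relevant.  An adjointable operator is automatically linear and bounded.\<close>

definition is_adjoint :: "('b, 'e) hilbert_module \<Rightarrow> ('e \<Rightarrow> 'e) \<Rightarrow> ('e \<Rightarrow> 'e) \<Rightarrow> bool"
  where "is_adjoint E T S \<longleftrightarrow> S \<in> carrier E \<rightarrow> carrier E \<and>
    (\<forall>x\<in>carrier E. \<forall>y\<in>carrier E. hinner E (T x) y = hinner E x (S y))"

definition adjointable :: "('b, 'e) hilbert_module \<Rightarrow> ('e \<Rightarrow> 'e) set"
  where "adjointable E = {T \<in> carrier E \<rightarrow> carrier E. \<exists>S. is_adjoint E T S}"

text \<open>The adjoint is unique on \<open>carrier E\<close>.\<close>

definition adj :: "('b, 'e) hilbert_module \<Rightarrow> ('e \<Rightarrow> 'e) \<Rightarrow> 'e \<Rightarrow> 'e"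
  where "adj E T = (SOME S. is_adjoint E T S)"

text \<open>The bound expresses that the operator norm of \<open>T - S\<close> is at most \<open>\<epsilon>\<close>.\<close>

definition op_closure ::
    "('b::cstar_algebra, 'e) hilbert_module \<Rightarrow> ('e \<Rightarrow> 'e) set \<Rightarrow> ('e \<Rightarrow> 'e) set"
  where "op_closure E W = {T \<in> adjointable E.
    \<forall>\<epsilon>>0. \<exists>S\<in>W. \<forall>x\<in>carrier E. hnorm E (T x \<ominus>\<^bsub>E\<^esub> S x) \<le> \<epsilon> * hnorm E x}"

definition finite_rank :: "('b::cstar_algebra, 'e) hilbert_module \<Rightarrow> ('e \<Rightarrow> 'e) set"
  where "finite_rank E = {T. \<exists>(n::nat) f g. (\<forall>i. f i \<in> carrier E \<and> g i \<in> carrier E) \<and>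
    (\<forall>x\<in>carrier E. T x = (\<Oplus>\<^bsub>E\<^esub>i\<in>{..<n}. act E (f i) (hinner E (g i) x)))}"

definition compact_operators :: "('b::cstar_algebra, 'e) hilbert_module \<Rightarrow> ('e \<Rightarrow> 'e) set"
  where "compact_operators E = op_closure E (finite_rank E)"


section \<open>Regular self-adjoint operators\<close>

record 'e unbounded_operator =
  Dom :: "'e set"
  app :: "'e \<Rightarrow> 'e"

definition densely_defined_operator ::
    "('b::cstar_algebra, 'e) hilbert_module \<Rightarrow> 'e unbounded_operator \<Rightarrow> bool"
  where "densely_defined_operator E D \<longleftrightarrow> hdense E (Dom D) \<and> app D \<in> Dom D \<rightarrow> carrier E \<and>
    \<zero>\<^bsub>E\<^esub> \<in> Dom D \<and>
    (\<forall>x\<in>Dom D. \<forall>y\<in>Dom D. x \<oplus>\<^bsub>E\<^esub> y \<in> Dom D \<and> app D (x \<oplus>\<^bsub>E\<^esub> y) = app D x \<oplus>\<^bsub>E\<^esub> app D y) \<and>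
    (\<forall>x\<in>Dom D. \<forall>c. c \<odot>\<^bsub>E\<^esub> x \<in> Dom D \<and> app D (c \<odot>\<^bsub>E\<^esub> x) = c \<odot>\<^bsub>E\<^esub> app D x) \<and>
    (\<forall>x\<in>Dom D. \<forall>b. act E x b \<in> Dom D \<and> app D (act E x b) = act E (app D x) b)"

definition closed_operator ::
    "('b::cstar_algebra, 'e) hilbert_module \<Rightarrow> 'e unbounded_operator \<Rightarrow> bool"
  where "closed_operator E D \<longleftrightarrow>
    (\<forall>X. \<forall>x\<in>carrier E. \<forall>y\<in>carrier E. (\<forall>n. X n \<in> Dom D) \<and> hconverges E X x \<and>
       hconverges E (\<lambda>n. app D (X n)) y \<longrightarrow> x \<in> Dom D \<and> app D x = y)"

text \<open>The graph of the adjoint \<open>D*\<close>.\<close>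

definition adjoint_graph ::
    "('b, 'e) hilbert_module \<Rightarrow> 'e unbounded_operator \<Rightarrow> ('e \<times> 'e) set"
  where "adjoint_graph E D = {(y, z). y \<in> carrier E \<and> z \<in> carrier E \<and>
    (\<forall>x\<in>Dom D. hinner E (app D x) y = hinner E x z)}"

text \<open>The set required to be dense at the end is the range of \<open>1 + D* D\<close>.\<close>

definition regular :: "('b::cstar_algebra, 'e) hilbert_module \<Rightarrow> 'e unbounded_operator \<Rightarrow> bool"
  where "regular E D \<longleftrightarrow> densely_defined_operator E D \<and> closed_operator E D \<and>
    hdense E (Domain (adjoint_graph E D)) \<and>
    hdense E {x \<oplus>\<^bsub>E\<^esub> z | x z. x \<in> Dom D \<and> (app D x, z) \<in> adjoint_graph E D}"

definition self_adjoint :: "('b, 'e) hilbert_module \<Rightarrow> 'e unbounded_operator \<Rightarrow> bool"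
  where "self_adjoint E D \<longleftrightarrow> adjoint_graph E D = {(x, app D x) | x. x \<in> Dom D}"

definition odd_operator :: "('b, 'e) hilbert_module \<Rightarrow> 'e unbounded_operator \<Rightarrow> bool"
  where "odd_operator E D \<longleftrightarrow>
    (\<forall>x\<in>Dom D. hgrade E x \<in> Dom D \<and> app D (hgrade E x) = \<ominus>\<^bsub>E\<^esub> hgrade E (app D x))"

text \<open>\<open>R = (1 + D\<^sup>2)\<^sup>-\<^sup>1\<^sup>/\<^sup>2\<close>, that is, \<open>R\<close> is the positive square root of the inverse of
  \<open>1 + D\<^sup>2\<close> (whose domain is \<open>Dom D\<^sup>2\<close>).  For regular self-adjoint \<open>D\<close> such an \<open>R\<close> exists and is
  unique on \<open>carrier E\<close>.\<close>

definition is_inv_sqrt ::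
    "('b::cstar_algebra, 'e) hilbert_module \<Rightarrow> 'e unbounded_operator \<Rightarrow> ('e \<Rightarrow> 'e) \<Rightarrow> bool"
  where "is_inv_sqrt E D R \<longleftrightarrow> R \<in> adjointable E \<and>
    (\<forall>x\<in>carrier E. positive (hinner E (R x) x)) \<and>
    (\<forall>x\<in>carrier E. R (R x) \<in> Dom D \<and> app D (R (R x)) \<in> Dom D \<and>
       R (R x) \<oplus>\<^bsub>E\<^esub> app D (app D (R (R x))) = x) \<and>
    (\<forall>x\<in>Dom D. app D x \<in> Dom D \<longrightarrow> R (R (x \<oplus>\<^bsub>E\<^esub> app D (app D x))) = x)"


section \<open>Lipschitz operators\<close>

definition even_part :: "('b, 'e) hilbert_module \<Rightarrow> ('e \<Rightarrow> 'e) \<Rightarrow> 'e \<Rightarrow> 'e"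
  where "even_part E T x = (1/2) \<odot>\<^bsub>E\<^esub> (T x \<oplus>\<^bsub>E\<^esub> hgrade E (T (hgrade E x)))"

definition odd_part :: "('b, 'e) hilbert_module \<Rightarrow> ('e \<Rightarrow> 'e) \<Rightarrow> 'e \<Rightarrow> 'e"
  where "odd_part E T x = (1/2) \<odot>\<^bsub>E\<^esub> (T x \<ominus>\<^bsub>E\<^esub> hgrade E (T (hgrade E x)))"

text \<open>The graded commutator \<open>[D, T]\<close> for odd \<open>D\<close>: the ordinary commutator with the even part of
  \<open>T\<close> plus the anticommutator with the odd part.  Meaningful on \<open>Dom D\<close> if \<open>T\<close> preserves
  \<open>Dom D\<close>.\<close>

definition graded_commutator ::
    "('b, 'e) hilbert_module \<Rightarrow> 'e unbounded_operator \<Rightarrow> ('e \<Rightarrow> 'e) \<Rightarrow> 'e \<Rightarrow> 'e"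
  where "graded_commutator E D T x =
    (app D (even_part E T x) \<ominus>\<^bsub>E\<^esub> even_part E T (app D x)) \<oplus>\<^bsub>E\<^esub>
    (app D (odd_part E T x) \<oplus>\<^bsub>E\<^esub> odd_part E T (app D x))"

definition Lip :: "('b, 'e) hilbert_module \<Rightarrow> 'e unbounded_operator \<Rightarrow> ('e \<Rightarrow> 'e) set"
  where "Lip E D = {T \<in> adjointable E. T ` Dom D \<subseteq> Dom D \<and>
    (\<exists>C\<in>adjointable E. \<forall>x\<in>Dom D. C x = graded_commutator E D T x)}"

definition Lip0 ::
    "('b::cstar_algebra, 'e) hilbert_module \<Rightarrow> 'e unbounded_operator \<Rightarrow> ('e \<Rightarrow> 'e) set"
  where "Lip0 E D = {T \<in> Lip E D. \<exists>R. is_inv_sqrt E D R \<and>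
    T \<circ> R \<in> compact_operators E \<and> adj E T \<circ> R \<in> compact_operators E}"


section \<open>Unbounded cycles\<close>

definition graded_representation ::
    "('b::graded_cstar_algebra, 'e) hilbert_module \<Rightarrow> ('a::graded_cstar_algebra \<Rightarrow> 'e \<Rightarrow> 'e) \<Rightarrow> bool"
  where "graded_representation E \<pi> \<longleftrightarrow>
    (\<forall>a. \<pi> a \<in> adjointable E) \<and>
    (\<forall>a b. \<forall>x\<in>carrier E. \<pi> (a + b) x = \<pi> a x \<oplus>\<^bsub>E\<^esub> \<pi> b x) \<and>
    (\<forall>a c. \<forall>x\<in>carrier E. \<pi> (c *\<^sub>C a) x = c \<odot>\<^bsub>E\<^esub> \<pi> a x) \<and>
    (\<forall>a b. \<forall>x\<in>carrier E. \<pi> (a * b) x = \<pi> a (\<pi> b x)) \<and>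
    (\<forall>a. \<forall>x\<in>carrier E. \<pi> (star a) x = adj E (\<pi> a) x) \<and>
    (\<forall>a. \<forall>x\<in>carrier E. \<pi> (grading a) x = hgrade E (\<pi> a (hgrade E x)))"

type_synonym ('a, 'b, 'e) cycle =
  "('a \<Rightarrow> 'e \<Rightarrow> 'e) \<times> ('b, 'e) hilbert_module \<times> 'e unbounded_operator"

fun unbounded_cycle :: "('a::graded_cstar_algebra, 'b::graded_cstar_algebra, 'e) cycle \<Rightarrow> bool"
  where "unbounded_cycle (\<pi>, E, D) \<longleftrightarrow>
    graded_hilbert_module E \<and> countably_generated E \<and>
    graded_representation E \<pi> \<and>
    regular E D \<and> self_adjoint E D \<and> odd_operator E D \<and>
    range \<pi> \<subseteq> op_closure E (Lip0 E D)"

definition rep_sum :: "('a \<Rightarrow> 'e \<Rightarrow> 'e) \<Rightarrow> ('a \<Rightarrow> 'f \<Rightarrow> 'f) \<Rightarrow> 'a \<Rightarrow> 'e \<times> 'f \<Rightarrow> 'e \<times> 'f"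
  where "rep_sum \<pi> \<rho> a = map_prod (\<pi> a) (\<rho> a)"

definition module_sum ::
    "('b::cstar_algebra, 'e) hilbert_module \<Rightarrow> ('b, 'f) hilbert_module \<Rightarrow> ('b, 'e \<times> 'f) hilbert_module"
  where "module_sum E F =
    \<lparr>carrier = carrier E \<times> carrier F, mult = undefined, one = undefined,
     zero = (\<zero>\<^bsub>E\<^esub>, \<zero>\<^bsub>F\<^esub>),
     add = (\<lambda>(x, y) (x', y'). (x \<oplus>\<^bsub>E\<^esub> x', y \<oplus>\<^bsub>F\<^esub> y')),
     smult = (\<lambda>c (x, y). (c \<odot>\<^bsub>E\<^esub> x, c \<odot>\<^bsub>F\<^esub> y)),
     act = (\<lambda>(x, y) b. (act E x b, act F y b)),
     hinner = (\<lambda>(x, y) (x', y'). hinner E x x' + hinner F y y'),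
     hgrade = map_prod (hgrade E) (hgrade F)\<rparr>"

definition operator_sum ::
    "'e unbounded_operator \<Rightarrow> 'f unbounded_operator \<Rightarrow> ('e \<times> 'f) unbounded_operator"
  where "operator_sum D D' = \<lparr>Dom = Dom D \<times> Dom D', app = map_prod (app D) (app D')\<rparr>"

fun cycle_sum ::
    "('a, 'b::cstar_algebra, 'e) cycle \<Rightarrow> ('a, 'b, 'f) cycle \<Rightarrow> ('a, 'b, 'e \<times> 'f) cycle"
  where "cycle_sum (\<pi>, E, D) (\<rho>, F, D') = (rep_sum \<pi> \<rho>, module_sum E F, operator_sum D D')"


section \<open>The semigroup of unbounded cycles\<close>

fun cycle_equiv ::
    "('a, 'b, 'e) cycle \<Rightarrow> ('a, 'b, 'f) cycle \<Rightarrow> bool"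
  where "cycle_equiv (\<pi>, E, D) (\<rho>, F, D') \<longleftrightarrow>
    (\<exists>U. bij_betw U (carrier E) (carrier F) \<and>
      (\<forall>x\<in>carrier E. \<forall>y\<in>carrier E. U (x \<oplus>\<^bsub>E\<^esub> y) = U x \<oplus>\<^bsub>F\<^esub> U y) \<and>
      (\<forall>x\<in>carrier E. \<forall>c. U (c \<odot>\<^bsub>E\<^esub> x) = c \<odot>\<^bsub>F\<^esub> U x) \<and>
      (\<forall>x\<in>carrier E. \<forall>b. U (act E x b) = act F (U x) b) \<and>
      (\<forall>x\<in>carrier E. \<forall>y\<in>carrier E. hinner F (U x) (U y) = hinner E x y) \<and>
      (\<forall>x\<in>carrier E. U (hgrade E x) = hgrade F (U x)) \<and>
      (\<forall>a. \<forall>x\<in>carrier E. U (\<pi> a x) = \<rho> a (U x)) \<and>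
      U ` Dom D = Dom D' \<and>
      (\<forall>x\<in>Dom D. U (app D x) = app D' (U x)))"

text \<open>As usual, cycles are identified up to unitary equivalence; on the nose, the direct sum is
  associative only up to the canonical unitary.  The classes are represented by cycles whose
  underlying set is contained in \<open>nat \<Rightarrow> 'b\<close>, which is large enough: an element of a countably
  generated Hilbert module over \<open>'b\<close> is determined by a sequence of finite families of
  coefficients in \<open>'b\<close>, so every cycle, on whatever type, has a nonempty class.\<close>

definition cycle_class ::
    "('a::graded_cstar_algebra, 'b::graded_cstar_algebra, 'e) cycle \<Rightarrow> ('a, 'b, nat \<Rightarrow> 'b) cycle set"
  where "cycle_class x = {z. unbounded_cycle z \<and> cycle_equiv z x}"

definition Psi1 ::
    "('a::graded_cstar_algebra, 'b::graded_cstar_algebra, nat \<Rightarrow> 'b) cycle set set"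
  where "Psi1 = {cycle_class x | x :: ('a, 'b, nat \<Rightarrow> 'b) cycle. unbounded_cycle x}"

definition class_sum ::
    "('a::graded_cstar_algebra, 'b::graded_cstar_algebra, nat \<Rightarrow> 'b) cycle set \<Rightarrow>
     ('a, 'b, nat \<Rightarrow> 'b) cycle set \<Rightarrow> ('a, 'b, nat \<Rightarrow> 'b) cycle set"
  where "class_sum P Q = (\<Union>x\<in>P. \<Union>y\<in>Q. cycle_class (cycle_sum x y))"

definition is_semigroup :: "'s set \<Rightarrow> ('s \<Rightarrow> 's \<Rightarrow> 's) \<Rightarrow> bool"
  where "is_semigroup S f \<longleftrightarrow> (\<forall>x\<in>S. \<forall>y\<in>S. f x y \<in> S) \<and>
    (\<forall>x\<in>S. \<forall>y\<in>S. \<forall>z\<in>S. f (f x y) z = f x (f y z))"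

end

theory Submission
  imports Defs
begin

text \<open>
  The direct sum is formed componentwise, and every axiom of an unbounded cycle involves the
  two summands separately, except where the inner product
  \<open>\<langle>x, x\<rangle> + \<langle>y, y\<rangle>\<close> of the sum enters: it has to be positive, it must vanish only at \<open>0\<close>, and
  convergence in its norm must be convergence in both components.  All three follow from two facts
  on positive elements \<open>p\<close>, \<open>q\<close> of a C*-algebra: \<open>p + q\<close> is positive, and
  \<open>\<parallel>p\<parallel> \<le> \<parallel>p + q\<parallel>\<close> (\<open>positive_add\<close> and \<open>norm_le_norm_add_positive\<close>).  They give
  \<open>max \<parallel>x\<parallel> \<parallel>y\<parallel> \<le> \<parallel>(x, y)\<parallel> \<le> \<parallel>x\<parallel> + \<parallel>y\<parallel>\<close>, and with these bounds completeness, density, closedness,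
  operator-norm closures and compactness pass from the summands to the sum.  In particular, if
  \<open>S\<close> and \<open>S'\<close> are elements of \<open>Lip\<^sup>0\<close> within \<open>\<epsilon>/2\<close> of \<open>\<pi> a\<close> and \<open>\<rho> a\<close>, then \<open>S \<oplus> S'\<close> is an element of
  \<open>Lip\<^sup>0\<close> of the sum within \<open>\<epsilon>\<close> of \<open>\<pi> a \<oplus> \<rho> a\<close>.

  Positivity is defined by the spectrum, so the two facts rest on the relation between
  norm and spectrum.  In a unital C*-algebra, a self-adjoint \<open>k\<close> of norm \<open>1\<close> has
  \<open>1\<close> or \<open>-1\<close> in its spectrum (\<open>norm_one_imp_not_invertible\<close>).  The proof
  factors a perturbation of \<open>1 - k\<^sup>2\<close> into squares of commuting self-adjoint elements and
  compares norms in the identity \<open>v\<^sup>* v = x\<^sup>2 + y\<^sup>2\<close>, valid for \<open>v = x + \<i> y\<close> with commuting self-adjoint \<open>x\<close>, \<open>y\<close>.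
  It follows that a self-adjoint \<open>h\<close> is positive iff
  \<open>\<parallel>t - h\<parallel> \<le> t\<close> for some \<open>t\<close>, a condition that is visibly stable under addition.  The general
  case is reduced to the unital one by the unitization, with a norm that is a C*-norm whether or
  not the algebra already has a unit.

  For the semigroup, classes are represented by cycles on sequences in \<open>B\<close>.  The underlying set of a
  countably generated module embeds into these by \<open>x \<mapsto> (\<langle>x, g\<^sub>n\<rangle>)\<^sub>n\<close> for a generating sequence \<open>g\<close>
  (\<open>inner_product_embedding\<close>), because an element orthogonal to a dense set is \<open>0\<close>.  All structure
  can be carried along the embedding, so the class of every cycle is nonempty and the sum of classes is the class
  of the sum; associativity is then the reassociation of triples.
\<close>

section \<open>Elementary identities in C*-algebras\<close>

lemma scaleC_1 [simp]: "1 *\<^sub>C x = (x :: 'a::cstar_algebra)"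
  using scaleC_of_real[of 1 x] by simp

lemma scaleC_0_left [simp]: "0 *\<^sub>C x = (0 :: 'a::cstar_algebra)"
  using scaleC_of_real[of 0 x] by simp

lemma scaleC_0_right [simp]: "c *\<^sub>C (0 :: 'a::cstar_algebra) = 0"
  using scaleC_add_right[of c 0 0] by simp

lemma scaleC_minus_left: "(- c) *\<^sub>C x = - (c *\<^sub>C (x :: 'a::cstar_algebra))"
  using scaleC_add_left[of "- c" c x] by (simp add: eq_neg_iff_add_eq_0)

lemma scaleC_minus_right: "c *\<^sub>C (- x) = - (c *\<^sub>C (x :: 'a::cstar_algebra))"
  using scaleC_add_right[of c "- x" x] by (simp add: eq_neg_iff_add_eq_0)

lemma scaleC_diff_right: "c *\<^sub>C (x - y) = c *\<^sub>C x - c *\<^sub>C (y :: 'a::cstar_algebra)"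
  using scaleC_add_right[of c x "- y"] by (simp add: scaleC_minus_right)

lemma scaleC_scaleR: "c *\<^sub>C (r *\<^sub>R x) = r *\<^sub>R (c *\<^sub>C (x :: 'a::cstar_algebra))"
  by (metis mult.commute scaleC_of_real scaleC_scaleC)

lemma star_zero [simp]: "star (0 :: 'a::cstar_algebra) = 0"
  using star_add[of "0::'a" 0] by simp

lemma star_minus: "star (- x) = - star (x :: 'a::cstar_algebra)"
  using star_add[of "- x" x] by (simp add: eq_neg_iff_add_eq_0)

lemma star_diff: "star (x - y) = star x - star (y :: 'a::cstar_algebra)"
  using star_add[of x "- y"] by (simp add: star_minus)

lemma star_scaleR: "star (r *\<^sub>R x) = r *\<^sub>R star (x :: 'a::cstar_algebra)"
  using star_scaleC[of "of_real r" x] by (simp add: scaleC_of_real)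

lemma norm_star: "norm (star x) = norm (x :: 'a::cstar_algebra)"
proof -
  have le: "norm y \<le> norm (star y)" for y :: 'a
  proof (cases "y = 0")
    case False
    have "(norm y)\<^sup>2 \<le> norm (star y) * norm y"
      by (metis cstar_identity norm_mult_ineq)
    then show ?thesis
      using False by (simp add: power2_eq_square)
  qed simp
  show ?thesis
    using le[of x] le[of "star x"] by (simp add: star_star)
qed

lemma bounded_linear_star: "bounded_linear (star :: 'a::cstar_algebra \<Rightarrow> 'a)"
  by (rule bounded_linear_intro[where K = 1]) (simp_all add: star_add star_scaleR norm_star)

section \<open>Invertible elements and square roots in unital C*-algebras\<close>

class unital_cstar_algebra = cstar_algebra + real_normed_algebra_1

lemma star_one [simp]: "star (1 :: 'a::unital_cstar_algebra) = 1"
  by (metis mult_1 mult_1_right star_mult star_star)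

lemma star_power: "star (x ^ n) = star (x :: 'a::unital_cstar_algebra) ^ n"
  by (induction n) (simp_all add: star_mult power_commutes)

definition invertible_element :: "'a::monoid_mult \<Rightarrow> bool"
  where "invertible_element x \<longleftrightarrow> (\<exists>y. x * y = 1 \<and> y * x = 1)"

lemma invertible_element_mult:
  assumes "invertible_element x" "invertible_element y"
  shows "invertible_element (x * y)"
proof -
  obtain x' y' where "x * x' = 1" "x' * x = 1" "y * y' = 1" "y' * y = 1"
    using assms unfolding invertible_element_def by blast
  then have "(x * y) * (y' * x') = 1 \<and> (y' * x') * (x * y) = 1"
    by (metis mult.assoc mult_1_right)
  then show ?thesis unfolding invertible_element_def by blast
qed

lemma invertible_element_scaleC:
  fixes x :: "'a::unital_cstar_algebra"
  assumes "c \<noteq> 0"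
  shows "invertible_element (c *\<^sub>C x) \<longleftrightarrow> invertible_element x"
proof -
  have *: "invertible_element (d *\<^sub>C y)" if inv: "invertible_element y" and d: "d \<noteq> 0" for d and y :: 'a
  proof -
    obtain z where z: "y * z = 1" "z * y = 1"
      using inv unfolding invertible_element_def by blast
    then have "(d *\<^sub>C y) * (inverse d *\<^sub>C z) = 1 \<and> (inverse d *\<^sub>C z) * (d *\<^sub>C y) = 1"
      using d by (simp add: mult_scaleC_left mult_scaleC_right scaleC_scaleC)
    then show ?thesis unfolding invertible_element_def by blast
  qed
  show ?thesis
  proof
    assume "invertible_element (c *\<^sub>C x)"
    from *[OF this, of "inverse c"] show "invertible_element x"
      using assms by (simp add: scaleC_scaleC)
  qed (rule *[OF _ assms])
qed

lemma invertible_element_scaleR: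
  fixes x :: "'a::unital_cstar_algebra"
  assumes "c \<noteq> 0"
  shows "invertible_element (c *\<^sub>R x) \<longleftrightarrow> invertible_element x"
  using invertible_element_scaleC[of "of_real c" x] assms by (simp add: scaleC_of_real)

lemma invertible_one_minus:
  fixes x :: "'a::{real_normed_algebra_1, banach}"
  assumes "norm x < 1"
  shows "invertible_element (1 - x)"
proof -
  have s: "summable (\<lambda>n. x ^ n)"
    using assms by (rule complete_algebra_summable_geometric)
  have t: "(\<lambda>n. x ^ n - x ^ Suc n) sums 1"
    using telescope_sums'[OF LIMSEQ_power_zero[OF assms]] by simp
  have "(\<Sum>n. x ^ n - x ^ Suc n) = (1 - x) * (\<Sum>n. x ^ n)"
    by (subst suminf_mult[OF s, symmetric]) (simp add: left_diff_distrib)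
  moreover have "(\<Sum>n. x ^ n - x ^ Suc n) = (\<Sum>n. x ^ n) * (1 - x)"
    by (subst suminf_mult2[OF s]) (simp add: right_diff_distrib power_commutes)
  ultimately show ?thesis
    using sums_unique[OF t] unfolding invertible_element_def by metis
qed

lemma invertible_scalar_minus:
  fixes x :: "'a::unital_cstar_algebra"
  assumes "norm x < cmod z"
  shows "invertible_element (z *\<^sub>C 1 - x)"
proof -
  have z: "z \<noteq> 0" using assms by auto
  have "norm (inverse z *\<^sub>C x) < 1"
    using assms z by (simp add: norm_scaleC norm_divide inverse_eq_divide divide_less_eq)
  then have "invertible_element (z *\<^sub>C (1 - inverse z *\<^sub>C x))"
    by (subst invertible_element_scaleC[OF z]) (rule invertible_one_minus)
  then show ?thesis
    using z by (simp add: scaleC_diff_right scaleC_scaleC)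
qed

text \<open>The root is the binomial series
  \<open>\<Sum>n. (1/2 choose n) (- x)\<^sup>n\<close>.  As a norm limit of real polynomials in \<open>x\<close> it is self-adjoint and
  commutes with everything that commutes with \<open>x\<close>; its square is \<open>1 - x\<close> by the Vandermonde identity.\<close>

lemma self_adjoint_sqrt_one_minus:
  fixes x :: "'a::unital_cstar_algebra"
  assumes sa: "star x = x" and x: "norm x < 1"
  obtains w where "star w = w" "w * w = 1 - x" "\<And>y. y * x = x * y \<Longrightarrow> y * w = w * y"
proof -
  define f where "f n = ((1/2 :: real) gchoose n) *\<^sub>R (- x) ^ n" for n
  define w where "w = (\<Sum>n. f n)"
  have s0: "summable (\<lambda>n. \<bar>(1/2 :: real) gchoose n\<bar> * norm x ^ n)"
  proof -
    have "ereal (norm (norm x)) < conv_radius (\<lambda>n. (1/2 :: real) gchoose n)"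
      using x by (simp add: conv_radius_gchoose)
    from abs_summable_in_conv_radius[OF this] show ?thesis
      by (simp add: abs_mult)
  qed
  have ns: "summable (\<lambda>n. norm (f n))"
    by (rule summable_comparison_test'[OF s0, of 0])
      (auto simp: f_def intro!: mult_left_mono order_trans[OF norm_power_ineq])
  have s: "summable f" using ns by (rule summable_norm_cancel)
  have "star w = (\<Sum>n. star (f n))"
    unfolding w_def by (rule bounded_linear.suminf[OF bounded_linear_star s])
  then have 1: "star w = w"
    by (simp add: f_def w_def star_scaleR star_power star_minus sa)
  \<comment> \<open>Vandermonde: the square has the binomial coefficients of exponent \<open>1/2 + 1/2 = 1\<close>, all but two of which vanish.\<close>
  have c: "(\<Sum>i\<le>k. f i * f (k - i)) = ((1::real) gchoose k) *\<^sub>R (- x) ^ k" for k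
  proof -
    have "(\<Sum>i\<le>k. f i * f (k - i))
        = (\<Sum>i\<le>k. (((1/2::real) gchoose i) * ((1/2) gchoose (k - i))) *\<^sub>R (- x) ^ k)"
      by (rule sum.cong) (auto simp: f_def simp flip: power_add)
    also have "\<dots> = (((1/2 + 1/2)::real) gchoose k) *\<^sub>R (- x) ^ k"
      using gbinomial_Vandermonde[of "1/2 :: real" "1/2" k]
      by (simp add: scaleR_sum_left[symmetric] atLeast0AtMost)
    finally show ?thesis by simp
  qed
  have "w * w = (\<Sum>k. ((1::real) gchoose k) *\<^sub>R (- x) ^ k)"
    unfolding w_def Cauchy_product[OF ns ns] c ..
  also have "\<dots> = (\<Sum>k\<in>{..1}. ((1::real) gchoose k) *\<^sub>R (- x) ^ k)"
  proof (rule suminf_finite)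
    fix k :: nat assume "k \<notin> {..1}"
    then have "(Suc 0 choose k) = 0" by (intro binomial_eq_0) auto
    then show "((1::real) gchoose k) *\<^sub>R (- x) ^ k = 0"
      by (simp add: binomial_gbinomial[of 1 k, where ?'a = real, simplified, symmetric])
  qed simp
  also have "\<dots> = 1 - x"
    by (simp add: numeral_2_eq_2 gbinomial_1 atMost_Suc)
  finally have 2: "w * w = 1 - x" .
  have 3: "y * w = w * y" if "y * x = x * y" for y
  proof -
    have "y * (- x) ^ n = (- x) ^ n * y" for n
    proof (induction n)
      case (Suc n)
      have "y * (- x) ^ Suc n = (- x) * (y * (- x) ^ n)"
        using that by (simp add: mult.assoc[symmetric])
      also have "\<dots> = (- x) ^ Suc n * y"
        by (simp add: Suc mult.assoc)
      finally show ?case .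
    qed simp
    then have "y * f n = f n * y" for n by (simp add: f_def)
    then show ?thesis
      unfolding w_def by (simp add: suminf_mult[OF s, symmetric] suminf_mult2[OF s])
  qed
  show thesis by (rule that[OF 1 2 3])
qed

section \<open>Norm and spectrum of self-adjoint elements\<close>

text \<open>Let \<open>G\<close> be an inverse of \<open>1 - k\<^sup>2\<close>.  For small \<open>\<epsilon>\<close> and for \<open>r < 1\<close>, both \<open>1 - \<epsilon> G = W\<^sup>2\<close> and
  \<open>1 - r\<^sup>2 k\<^sup>2 = Q\<^sup>2\<close> have self-adjoint roots, and \<open>k\<close>, \<open>Q\<close>, \<open>W\<close> commute.  Hence \<open>V = r k + \<i> Q W\<close> satisfies
  \<open>V\<^sup>* V = r\<^sup>2 k\<^sup>2 + (1 - r\<^sup>2 k\<^sup>2)(1 - \<epsilon> G) = 1 - \<epsilon> r\<^sup>2 - \<epsilon> (1 - r\<^sup>2) G\<close>, as \<open>k\<^sup>2 G = G - 1\<close>.  For \<open>r\<close> near \<open>1\<close> the right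
  side has norm close to \<open>1 - \<epsilon>\<close>, whereas \<open>r k\<close> is the mean of \<open>V\<close> and \<open>V\<^sup>*\<close> and so has
  norm \<open>r \<le> \<parallel>V\<parallel>\<close>: a contradiction.\<close>

theorem norm_one_imp_not_invertible:
  fixes k :: "'a::unital_cstar_algebra"
  assumes sa: "star k = k" and k: "norm k = 1"
  shows "\<not> invertible_element (1 - k * k)"
proof
  assume "invertible_element (1 - k * k)"
  then obtain G where G: "(1 - k * k) * G = 1" "G * (1 - k * k) = 1"
    unfolding invertible_element_def by blast
  have commG: "y * G = G * y" if "y * (k * k) = (k * k) * y" for y
  proof -
    have "y * (1 - k * k) = (1 - k * k) * y"
      using that by (simp add: algebra_simps)
    then have "(G * y) * ((1 - k * k) * G) = (G * (1 - k * k)) * (y * G)"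
      by (metis mult.assoc)
    then show ?thesis by (simp add: G)
  qed
  have kG: "k * G = G * k" by (rule commG) (simp add: mult.assoc)
  have "star ((1 - k * k) * G) = 1" using G by simp
  then have "star G * (1 - k * k) = 1"
    by (simp add: star_mult star_diff sa)
  then have "star G * ((1 - k * k) * G) = G"
    by (simp only: mult.assoc[symmetric] mult_1)
  then have saG: "star G = G" by (simp add: G)
  \<comment> \<open>Small enough that \<open>1 - \<epsilon> G\<close> has a square root.\<close>
  define \<epsilon> where "\<epsilon> = 1 / (2 * (norm G + 1))"
  have \<epsilon>: "\<epsilon> > 0" "\<epsilon> \<le> 1/2" "\<epsilon> * norm G < 1"
  proof -
    have "0 < norm G + 1" using norm_ge_zero[of G] by linarith
    then show "\<epsilon> > 0" "\<epsilon> \<le> 1/2" "\<epsilon> * norm G < 1"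
      by (simp_all add: \<epsilon>_def divide_le_eq divide_less_eq)
  qed
  have "star (\<epsilon> *\<^sub>R G) = \<epsilon> *\<^sub>R G" "norm (\<epsilon> *\<^sub>R G) < 1"
    using \<epsilon> by (simp_all add: star_scaleR saG)
  then obtain W where W: "star W = W" "W * W = 1 - \<epsilon> *\<^sub>R G" "\<And>y. y * (\<epsilon> *\<^sub>R G) = (\<epsilon> *\<^sub>R G) * y \<Longrightarrow> y * W = W * y"
    by (rule self_adjoint_sqrt_one_minus) blast
  \<comment> \<open>The final estimate reads \<open>\<epsilon> < \<delta> (2 + \<epsilon>)\<close>, which \<open>\<delta> = \<epsilon> / 3\<close> and \<open>\<epsilon> < 1\<close> contradict.\<close>
  define \<delta> where "\<delta> = \<epsilon> / 3"
  define r where "r = sqrt (1 - \<delta>)"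
  have r: "r * r = 1 - \<delta>" "r \<ge> 0" "\<delta> > 0"
    using \<epsilon> by (auto simp: \<delta>_def r_def)
  have "norm ((r * r) *\<^sub>R (k * k)) \<le> (r * r) * (norm k * norm k)"
    using r(2) norm_mult_ineq[of k k] by (simp add: mult_left_mono)
  then have "norm ((r * r) *\<^sub>R (k * k)) < 1"
    using r k by simp
  moreover have "star ((r * r) *\<^sub>R (k * k)) = (r * r) *\<^sub>R (k * k)"
    by (simp add: star_scaleR star_mult sa)
  ultimately obtain Q where Q: "star Q = Q" "Q * Q = 1 - (r * r) *\<^sub>R (k * k)"
    "\<And>y. y * ((r * r) *\<^sub>R (k * k)) = ((r * r) *\<^sub>R (k * k)) * y \<Longrightarrow> y * Q = Q * y"
    by (metis self_adjoint_sqrt_one_minus)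
  have kQ: "k * Q = Q * k" by (rule Q(3)) (simp add: mult.assoc)
  have kW: "k * W = W * k" by (rule W(3)) (simp add: kG)
  have "Q * (k * k) = (k * k) * Q" by (simp only: mult.assoc kQ[symmetric]) (simp only: mult.assoc[symmetric] kQ)
  then have QW: "Q * W = W * Q" by (intro W(3)) (simp add: commG)
  define P where "P = Q * W"
  have P: "star P = P" "k * P = P * k"
  proof -
    show "star P = P" by (simp add: P_def star_mult Q(1) W(1) QW)
    have "k * P = (k * Q) * W" by (simp add: P_def mult.assoc)
    also have "\<dots> = Q * (k * W)" by (simp add: kQ mult.assoc)
    also have "\<dots> = P * k" by (simp add: P_def kW mult.assoc)
    finally show "k * P = P * k" .
  qed
  have "P * P = Q * (W * Q) * W" by (simp only: P_def mult.assoc)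
  also have "\<dots> = (Q * Q) * (W * W)" by (simp only: QW[symmetric] mult.assoc)
  also have "\<dots> = 1 - (r * r) *\<^sub>R (k * k) - \<epsilon> *\<^sub>R G + (\<epsilon> * (r * r)) *\<^sub>R (k * k * G)"
    by (simp add: Q(2) W(2) algebra_simps)
  also have "k * k * G = G - 1"
    using G(1) by (simp add: algebra_simps)
  finally have PP: "P * P = 1 - (r * r) *\<^sub>R (k * k) - \<epsilon> *\<^sub>R G + (\<epsilon> * (r * r)) *\<^sub>R (G - 1)" .
  define V where "V = r *\<^sub>R k + \<i> *\<^sub>C P"
  have sV: "star V = r *\<^sub>R k - \<i> *\<^sub>C P"
    by (simp add: V_def star_add star_scaleR star_scaleC sa P scaleC_minus_left)
  have "\<i> *\<^sub>C \<i> *\<^sub>C (P * P) = - (P * P)"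
    by (simp add: scaleC_scaleC scaleC_minus_left)
  then have "star V * V = (r * r) *\<^sub>R (k * k) + P * P"
    unfolding sV unfolding V_def
    by (simp add: algebra_simps mult_scaleC_left mult_scaleC_right P(2) scaleC_scaleR scaleC_diff_right)
  also have "\<dots> = (1 - \<epsilon> * (r * r)) *\<^sub>R 1 - (\<epsilon> * \<delta>) *\<^sub>R G"
    by (simp add: PP r algebra_simps)
  finally have VV: "(norm V)\<^sup>2 = norm ((1 - \<epsilon> * (r * r)) *\<^sub>R 1 - (\<epsilon> * \<delta>) *\<^sub>R G)"
    by (metis cstar_identity)
  also have "\<dots> \<le> \<bar>1 - \<epsilon> * (r * r)\<bar> + \<bar>\<epsilon> * \<delta>\<bar> * norm G"
    by (rule order_trans[OF norm_triangle_ineq4]) simp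
  also have "\<bar>1 - \<epsilon> * (r * r)\<bar> = 1 - \<epsilon> * (1 - \<delta>)"
    using r(1,3) \<epsilon> mult_mono[of \<epsilon> 1 "1 - \<delta>" 1] by (auto simp: \<delta>_def)
  also have "\<bar>\<epsilon> * \<delta>\<bar> * norm G = \<delta> * (\<epsilon> * norm G)"
    using \<epsilon> r by simp
  also have "\<dots> < \<delta> * 1" using \<epsilon>(3) r(3) by (intro mult_strict_left_mono) auto
  finally have 1: "(norm V)\<^sup>2 < 1 - \<epsilon> * (1 - \<delta>) + \<delta>" by simp
  have "(2 * r) *\<^sub>R k = V + star V"
    by (simp add: sV) (simp add: V_def scaleR_2 flip: scaleR_scaleR)
  then have "2 * r \<le> norm V + norm (star V)"
    using norm_triangle_ineq[of V "star V"] k r(2) by (metis abs_of_nonneg mult_1_right norm_scaleR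
      mult_nonneg_nonneg zero_le_numeral)
  then have "r \<le> norm V" by (simp add: norm_star)
  then have "r * r \<le> (norm V)\<^sup>2"
    using r(2) by (simp add: power2_eq_square mult_mono)
  then have "1 - \<delta> < 1 - \<epsilon> * (1 - \<delta>) + \<delta>" using 1 r by simp
  moreover have "\<epsilon> * \<delta> \<le> \<delta>" using \<epsilon> r by (simp add: mult_le_cancel_right1)
  ultimately show False using r(3) by (simp add: \<delta>_def algebra_simps)
qed

text \<open>Adding \<open>\<i> s\<close> with \<open>s\<close> real to \<open>h\<close> increases the square of the norm at most by \<open>s\<^sup>2\<close>, but it moves a
  non-real \<open>z\<close> in such a way that \<open>|z + \<i> s|\<^sup>2\<close> grows by \<open>s\<^sup>2 + 2 s Im z\<close>.  For suitable \<open>s\<close>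
  the shifted \<open>z\<close> is therefore larger than the norm of the shifted \<open>h\<close> (Arens' argument).\<close>

lemma self_adjoint_real_spectrum:
  fixes h :: "'a::unital_cstar_algebra"
  assumes sa: "star h = h" and z: "Im z \<noteq> 0"
  shows "invertible_element (z *\<^sub>C 1 - h)"
proof -
  \<comment> \<open>Then \<open>2 s Im z\<close> exceeds \<open>\<parallel>h\<parallel>\<^sup>2\<close>.\<close>
  define s where "s = ((norm h)\<^sup>2 + 1) / (2 * Im z)"
  define x where "x = h + (\<i> * of_real s) *\<^sub>C 1"
  have "star x = h + (- (\<i> * of_real s)) *\<^sub>C 1"
    by (simp add: x_def star_add sa star_scaleC)
  moreover have "(\<i> * of_real s) * (\<i> * of_real s) = - (of_real (s * s) :: complex)"
    by (simp add: algebra_simps)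
  ultimately have "star x * x = h * h + (s * s) *\<^sub>R 1"
    unfolding x_def
    by (simp add: distrib_left distrib_right left_diff_distrib scaleC_diff_right mult_scaleC_left mult_scaleC_right scaleC_minus_left
      scaleC_add_right scaleC_scaleC scaleC_minus_right flip: scaleC_of_real)
  then have "(norm x)\<^sup>2 = norm (h * h + (s * s) *\<^sub>R 1)"
    by (metis cstar_identity)
  also have "\<dots> \<le> norm h * norm h + s * s"
    by (rule order_trans[OF norm_triangle_ineq]) (auto intro: add_mono norm_mult_ineq)
  also have "\<dots> < (cmod (z + \<i> * of_real s))\<^sup>2"
  proof -
    have "2 * Im z * s = (norm h)\<^sup>2 + 1" using z by (simp add: s_def)
    then have "(cmod (z + \<i> * of_real s))\<^sup>2 = (Re z)\<^sup>2 + (Im z)\<^sup>2 + (norm h)\<^sup>2 + 1 + s * s"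
      unfolding cmod_power2 by (simp add: power2_eq_square algebra_simps)
    then show ?thesis
      using zero_le_power2[of "Re z"] zero_le_power2[of "Im z"]
      unfolding power2_eq_square by linarith
  qed
  finally have "norm x < cmod (z + \<i> * of_real s)"
    by (rule power_less_imp_less_base) simp
  from invertible_scalar_minus[OF this] show ?thesis
    by (simp add: x_def scaleC_add_left)
qed

text \<open>If the norm \<open>s\<close> of \<open>t - h\<close> exceeded \<open>t\<close>, then \<open>k = (t - h) / s\<close> would have
  norm \<open>1\<close>, while \<open>1 - k = ((s - t) + h) / s\<close> is invertible by assumption and \<open>1 + k = ((s + t) - h) / s\<close>
  because \<open>s + t\<close> exceeds the norm of \<open>h\<close>.\<close>

lemma norm_scalar_minus_le:
  fixes h :: "'a::unital_cstar_algebra"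
  assumes sa: "star h = h" and t: "norm h \<le> t"
    and inv: "\<And>s. s > 0 \<Longrightarrow> invertible_element (s *\<^sub>R 1 + h)"
  shows "norm (t *\<^sub>R 1 - h) \<le> t"
proof (rule ccontr)
  define s where "s = norm (t *\<^sub>R 1 - h)"
  assume "\<not> norm (t *\<^sub>R 1 - h) \<le> t"
  then have s: "s > t" by (simp add: s_def)
  have t0: "t \<ge> 0" using t norm_ge_zero[of h] by linarith
  define k where "k = inverse s *\<^sub>R (t *\<^sub>R 1 - h)"
  have "1 - k = inverse s *\<^sub>R ((s - t) *\<^sub>R 1 + h)"
    using s t0 by (simp add: k_def algebra_simps)
  then have i1: "invertible_element (1 - k)"
    using s t0 inv[of "s - t"] by (simp add: invertible_element_scaleR)
  have "1 + k = inverse s *\<^sub>R (of_real (s + t) *\<^sub>C 1 - h)"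
    using s t0 unfolding scaleC_of_real by (simp add: k_def algebra_simps)
  moreover have "invertible_element (of_real (s + t) *\<^sub>C 1 - h)"
    using s t t0 by (intro invertible_scalar_minus) (simp del: of_real_add)
  ultimately have i2: "invertible_element (1 + k)"
    using s t0 by (simp add: invertible_element_scaleR)
  have "(1 - k) * (1 + k) = 1 - k * k" by (simp add: algebra_simps)
  then have "invertible_element (1 - k * k)"
    using invertible_element_mult[OF i1 i2] by simp
  moreover have "norm k = 1" using s t0 by (simp add: k_def s_def[symmetric])
  moreover have "star k = k" by (simp add: k_def star_scaleR star_diff sa)
  ultimately show False using norm_one_imp_not_invertible by blast
qed

text \<open>The converse of \<open>norm_scalar_minus_le\<close>, by the Neumann series for \<open>s + h = (s + t) - (t - h)\<close>.\<close>

lemma invertible_pos_plus: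
  fixes h :: "'a::unital_cstar_algebra"
  assumes "norm (t *\<^sub>R 1 - h) \<le> t" "s > 0"
  shows "invertible_element (s *\<^sub>R 1 + h)"
proof -
  have "invertible_element (of_real (s + t) *\<^sub>C 1 - (t *\<^sub>R 1 - h))"
    using assms norm_ge_zero[of "t *\<^sub>R 1 - h"]
    by (intro invertible_scalar_minus) (simp del: of_real_add)
  then show ?thesis unfolding scaleC_of_real by (simp add: algebra_simps)
qed

lemma norm_scalar_minus_add_le:
  fixes p :: "'a::unital_cstar_algebra"
  assumes "norm (s *\<^sub>R 1 - p) \<le> s" "norm (t *\<^sub>R 1 - q) \<le> t"
  shows "norm ((s + t) *\<^sub>R 1 - (p + q)) \<le> s + t"
proof -
  have "(s + t) *\<^sub>R 1 - (p + q) = (s *\<^sub>R 1 - p) + (t *\<^sub>R 1 - q)"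
    by (simp add: algebra_simps)
  then show ?thesis using norm_triangle_le[OF add_mono[OF assms]] by (simp only:)
qed

text \<open>If \<open>s = \<parallel>p\<parallel>\<close> exceeded \<open>t = \<parallel>p + q\<parallel>\<close>, then \<open>k = p / s\<close> would have norm \<open>1\<close> with \<open>1 + k\<close>
  invertible.  But \<open>s - p = (s - t) + (t - (p + q)) + q\<close>, where both \<open>t - (p + q)\<close> and \<open>q\<close>
  satisfy the norm criterion for positivity, so \<open>1 - k\<close> is invertible as well.\<close>

lemma norm_le_norm_add_unital:
  fixes p q :: "'a::unital_cstar_algebra"
  assumes sa: "star p = p" "star q = q"
    and inv: "\<And>s. s > 0 \<Longrightarrow> invertible_element (s *\<^sub>R 1 + p)" "\<And>s. s > 0 \<Longrightarrow> invertible_element (s *\<^sub>R 1 + q)"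
  shows "norm p \<le> norm (p + q)"
proof (rule ccontr)
  assume c: "\<not> norm p \<le> norm (p + q)"
  define t where "t = norm (p + q)"
  define s where "s = norm p"
  have s: "s > t" "t \<ge> 0" using c by (simp_all add: s_def t_def)
  define k where "k = inverse s *\<^sub>R p"
  have "1 + k = inverse s *\<^sub>R (s *\<^sub>R 1 + p)"
    using s by (simp add: k_def algebra_simps)
  then have i1: "invertible_element (1 + k)"
    using s inv(1)[of s] by (simp add: invertible_element_scaleR)
  have q: "norm (norm q *\<^sub>R 1 - q) \<le> norm q"
    by (rule norm_scalar_minus_le[OF sa(2) _ inv(2)]) simp_all
  have "norm (t *\<^sub>R 1 - (t *\<^sub>R 1 - (p + q))) \<le> t" by (simp add: t_def add.commute)
  from norm_scalar_minus_add_le[OF this q]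
  have "invertible_element ((s - t) *\<^sub>R 1 + (t *\<^sub>R 1 - (p + q) + q))"
    by (rule invertible_pos_plus) (use s in simp)
  moreover have "1 - k = inverse s *\<^sub>R ((s - t) *\<^sub>R 1 + (t *\<^sub>R 1 - (p + q) + q))"
    using s by (simp add: k_def algebra_simps)
  ultimately have i2: "invertible_element (1 - k)"
    using s by (simp add: invertible_element_scaleR)
  have "(1 - k) * (1 + k) = 1 - k * k" by (simp add: algebra_simps)
  then have "invertible_element (1 - k * k)"
    using invertible_element_mult[OF i2 i1] by simp
  moreover have "norm k = 1" using s by (simp add: k_def s_def[symmetric])
  moreover have "star k = k" by (simp add: k_def star_scaleR sa)
  ultimately show False using norm_one_imp_not_invertible by blast
qed

section \<open>The unitization of a C*-algebra\<close>

datatype 'a unitization = Unitization (algebra_part: 'a) (scalar_part: complex)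

text \<open>The action of the unitization on the algebra, which is an ideal in it.\<close>

definition left_mult :: "'a::cstar_algebra unitization \<Rightarrow> 'a \<Rightarrow> 'a"
  where "left_mult x a = algebra_part x * a + scalar_part x *\<^sub>C a"

text \<open>The operator norm of \<open>left_mult\<close> alone is only a seminorm if the algebra has a unit \<open>e\<close>, because
  \<open>1 - e\<close> acts by zero.  The scalar part is a character, so taking the maximum with its absolute value keeps the
  C*-identity and separates points in every case.\<close>

instantiation unitization :: (cstar_algebra) real_normed_algebra
begin

definition "0 = Unitization 0 0"
definition "x + y = Unitization (algebra_part x + algebra_part y) (scalar_part x + scalar_part y)"
definition "x - y = Unitization (algebra_part x - algebra_part y) (scalar_part x - scalar_part y)"
definition "- x = Unitization (- algebra_part x) (- scalar_part x)"
definition "x * y = Unitization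
  (algebra_part x * algebra_part y + scalar_part x *\<^sub>C algebra_part y + scalar_part y *\<^sub>C algebra_part x)
  (scalar_part x * scalar_part y)"
definition "r *\<^sub>R x = Unitization (r *\<^sub>R algebra_part x) (of_real r * scalar_part x)"
definition "norm x = max (cmod (scalar_part x)) (onorm (left_mult x))"
definition "sgn x = inverse (norm x) *\<^sub>R x" for x :: "'a unitization"
definition "dist x y = norm (x - y)" for x y :: "'a unitization"
definition "(uniformity :: ('a unitization \<times> 'a unitization) filter) =
  (INF e\<in>{0 <..}. principal {(x, y). dist x y < e})"
definition "open U = (\<forall>x\<in>U. eventually (\<lambda>(x', y). x' = x \<longrightarrow> y \<in> U) uniformity)"
  for U :: "'a unitization set"

lemma unitization_parts [simp]:
  "algebra_part (0 :: 'a unitization) = 0" "scalar_part (0 :: 'a unitization) = 0"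
  "algebra_part (x + y) = algebra_part x + algebra_part y"
  "scalar_part (x + y) = scalar_part x + scalar_part y"
  "algebra_part (x - y) = algebra_part x - algebra_part y"
  "scalar_part (x - y) = scalar_part x - scalar_part y"
  "algebra_part (- x) = - algebra_part x" "scalar_part (- x) = - scalar_part x"
  "algebra_part (x * y) = algebra_part x * algebra_part y + scalar_part x *\<^sub>C algebra_part y
    + scalar_part y *\<^sub>C algebra_part x"
  "scalar_part (x * y) = scalar_part x * scalar_part y"
  "algebra_part (r *\<^sub>R x) = r *\<^sub>R algebra_part x" "scalar_part (r *\<^sub>R x) = of_real r * scalar_part x"
  for x y :: "'a unitization"
  by (simp_all add: zero_unitization_def plus_unitization_def minus_unitization_def
    uminus_unitization_def times_unitization_def scaleR_unitization_def)

lemma bounded_linear_left_mult: "bounded_linear (left_mult (x :: 'a unitization))"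
proof (rule bounded_linear_intro)
  show "norm (left_mult x a) \<le> norm a * (norm (algebra_part x) + cmod (scalar_part x))" for a
    unfolding left_mult_def distrib_left
    by (intro norm_triangle_le add_mono) (simp_all add: norm_scaleC norm_mult_ineq mult.commute[of "norm a"])
qed (simp_all add: left_mult_def algebra_simps scaleC_add_right scaleC_scaleR)

lemma left_mult_le: "norm (left_mult (x :: 'a unitization) a) \<le> norm x * norm a"
proof -
  have "norm (left_mult x a) \<le> onorm (left_mult x) * norm a"
    by (rule onorm[OF bounded_linear_left_mult])
  also have "\<dots> \<le> norm x * norm a"
    by (simp add: norm_unitization_def mult_right_mono)
  finally show ?thesis .
qed

lemma scalar_part_le: "cmod (scalar_part x) \<le> norm (x :: 'a unitization)"
  by (simp add: norm_unitization_def)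

lemma norm_unitization_leI:
  assumes "cmod (scalar_part x) \<le> b" "\<And>a. norm (left_mult x a) \<le> b * norm a"
  shows "norm (x :: 'a unitization) \<le> b"
  unfolding norm_unitization_def
  by (intro max.boundedI onorm_bound assms order_trans[OF norm_ge_zero assms(1)])

lemma left_mult_add: "left_mult (x + y) a = left_mult x a + left_mult (y :: 'a unitization) a"
  by (simp add: left_mult_def algebra_simps scaleC_add_left)

lemma left_mult_mult: "left_mult (x * y) a = left_mult x (left_mult (y :: 'a unitization) a)"
  by (simp add: left_mult_def algebra_simps scaleC_add_right scaleC_scaleC mult_scaleC_left mult_scaleC_right)

lemma unitization_norm_mult: "norm (x * y) \<le> norm x * norm (y :: 'a unitization)"
proof (rule norm_unitization_leI)
  show "cmod (scalar_part (x * y)) \<le> norm x * norm y"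
    by (simp add: norm_mult mult_mono scalar_part_le order_trans[OF norm_ge_zero scalar_part_le])
  show "norm (left_mult (x * y) a) \<le> norm x * norm y * norm a" for a
    unfolding left_mult_mult
    by (rule order_trans[OF left_mult_le])
      (simp add: mult.assoc mult_left_mono left_mult_le order_trans[OF norm_ge_zero scalar_part_le])
qed

lemma unitization_norm_zero:
  assumes "norm x = 0" shows "x = (0 :: 'a unitization)"
proof -
  have s: "scalar_part x = 0" using scalar_part_le[of x] assms by simp
  then have "norm (algebra_part x * star (algebra_part x)) = 0"
    using left_mult_le[of x "star (algebra_part x)"] assms by (simp add: left_mult_def)
  then have "algebra_part x = 0"
    using cstar_identity[of "star (algebra_part x)"] by (simp add: star_star norm_star)
  then show ?thesis using s by (intro unitization.expand) simp
qed

instance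
proof
  fix x y z :: "'a unitization" and r s :: real
  show "x + y + z = x + (y + z)" "x + y = y + x" "0 + x = x" "- x + x = 0" "x - y = x + - y"
    "r *\<^sub>R (x + y) = r *\<^sub>R x + r *\<^sub>R y" "(r + s) *\<^sub>R x = r *\<^sub>R x + s *\<^sub>R x"
    "r *\<^sub>R s *\<^sub>R x = (r * s) *\<^sub>R x" "1 *\<^sub>R x = x"
    by (rule unitization.expand; simp add: algebra_simps)+
  show "x * y * z = x * (y * z)" "(x + y) * z = x * z + y * z" "x * (y + z) = x * y + x * z"
    "r *\<^sub>R x * y = r *\<^sub>R (x * y)" "x * r *\<^sub>R y = r *\<^sub>R (x * y)"
    by (rule unitization.expand; simp add: algebra_simps scaleC_add_left scaleC_add_right scaleC_scaleC
      mult_scaleC_left mult_scaleC_right scaleC_scaleR flip: scaleC_of_real)+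
  show "norm (x * y) \<le> norm x * norm y" by (rule unitization_norm_mult)
  show "norm (x + y) \<le> norm x + norm y"
    by (rule norm_unitization_leI)
      (auto simp: left_mult_add distrib_right intro!: norm_triangle_le add_mono scalar_part_le left_mult_le)
  have "left_mult (r *\<^sub>R x) = (\<lambda>a. r *\<^sub>R left_mult x a)"
    by (simp add: fun_eq_iff left_mult_def scaleC_add_right mult_scaleC_left scaleC_scaleC flip: scaleC_of_real)
  then show "norm (r *\<^sub>R x) = \<bar>r\<bar> * norm x"
    by (simp add: norm_unitization_def norm_mult onorm_scaleR[OF bounded_linear_left_mult] max_mult_distrib_left)
  show "norm x = 0 \<longleftrightarrow> x = 0"
  proof
    show "norm x = 0 \<Longrightarrow> x = 0" by (rule unitization_norm_zero)
    have "norm (0 :: 'a unitization) \<le> 0"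
      by (rule norm_unitization_leI) (simp_all add: left_mult_def)
    then show "x = 0 \<Longrightarrow> norm x = 0"
      using order_trans[OF norm_ge_zero scalar_part_le, of x] by auto
  qed
qed (rule sgn_unitization_def dist_unitization_def uniformity_unitization_def open_unitization_def)+

end

text \<open>The lower bound comes from the action on \<open>star x\<close>, by the C*-identity.\<close>

lemma norm_Unitization [simp]: "norm (Unitization x 0) = norm (x :: 'a::cstar_algebra)"
proof (rule antisym)
  show "norm (Unitization x 0) \<le> norm x"
    by (rule norm_unitization_leI) (simp_all add: left_mult_def norm_mult_ineq)
  have "(norm x)\<^sup>2 \<le> norm (Unitization x 0) * norm x"
    using left_mult_le[of "Unitization x 0" "star x"] cstar_identity[of "star x"]
    by (simp add: left_mult_def star_star norm_star)
  then show "norm x \<le> norm (Unitization x 0)"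
    by (cases "x = 0") (simp_all add: power2_eq_square)
qed

text \<open>Together with the bounds on the two parts, this makes the norm equivalent to the sum
  norm on pairs, hence complete.\<close>

lemma norm_Unitization_le: "norm (Unitization a c) \<le> norm (a :: 'a::cstar_algebra) + cmod c"
proof -
  have "norm (Unitization 0 c :: 'a unitization) \<le> cmod c"
    by (rule norm_unitization_leI) (simp_all add: left_mult_def norm_scaleC)
  moreover have "Unitization a c = Unitization a 0 + Unitization 0 c"
    by (rule unitization.expand) simp
  ultimately show ?thesis
    by (metis add_left_mono norm_Unitization norm_triangle_le)
qed

lemma algebra_part_le: "norm (algebra_part x) \<le> 2 * norm (x :: 'a::cstar_algebra unitization)"
proof -
  have "Unitization (algebra_part x) 0 = x - Unitization 0 (scalar_part x)"
    by (rule unitization.expand) simp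
  then have "norm (algebra_part x) \<le> norm x + norm (Unitization 0 (scalar_part x) :: 'a unitization)"
    by (metis norm_Unitization norm_triangle_ineq4)
  then show ?thesis
    using norm_Unitization_le[of "0::'a" "scalar_part x"] scalar_part_le[of x] by simp
qed

instance unitization :: (cstar_algebra) banach
proof
  fix X :: "nat \<Rightarrow> 'a unitization" assume X: "Cauchy X"
  have 1: "bounded_linear (algebra_part :: 'a unitization \<Rightarrow> 'a)"
    by (rule bounded_linear_intro[where K = 2]) (simp_all add: algebra_part_le mult.commute[of _ 2])
  have 2: "bounded_linear (scalar_part :: 'a unitization \<Rightarrow> complex)"
    by (rule bounded_linear_intro[where K = 1]) (simp_all add: scalar_part_le scaleR_conv_of_real)
  obtain a c where ac: "(\<lambda>n. algebra_part (X n)) \<longlonglongrightarrow> a" "(\<lambda>n. scalar_part (X n)) \<longlonglongrightarrow> c"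
    using bounded_linear.Cauchy[OF 1 X] bounded_linear.Cauchy[OF 2 X]
    by (auto simp: Cauchy_convergent_iff convergent_def)
  have "(\<lambda>n. norm (algebra_part (X n) - a) + cmod (scalar_part (X n) - c)) \<longlonglongrightarrow> 0"
    using ac by (intro tendsto_add_zero tendsto_norm_zero) (simp_all add: LIM_zero)
  then have "(\<lambda>n. norm (X n - Unitization a c)) \<longlonglongrightarrow> 0"
  proof (rule Lim_null_comparison[rotated])
    show "\<forall>\<^sub>F n in sequentially. norm (norm (X n - Unitization a c))
        \<le> norm (algebra_part (X n) - a) + cmod (scalar_part (X n) - c)"
      using norm_Unitization_le[of "algebra_part (X n) - a" "scalar_part (X n) - c" for n]
      by (simp add: minus_unitization_def)
  qed
  then show "convergent X"
    unfolding convergent_def using LIM_zero_iff tendsto_norm_zero_iff by blast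
qed

instantiation unitization :: (cstar_algebra) cstar_algebra
begin

definition "c *\<^sub>C x = Unitization (c *\<^sub>C algebra_part x) (c * scalar_part x)"
definition "star x = Unitization (star (algebra_part x)) (cnj (scalar_part x))"

lemma unitization_scaleC_star_parts [simp]:
  "algebra_part (c *\<^sub>C x) = c *\<^sub>C algebra_part x" "scalar_part (c *\<^sub>C x) = c * scalar_part x"
  "algebra_part (star x) = star (algebra_part x)" "scalar_part (star x) = cnj (scalar_part x)"
  for x y :: "'a unitization"
  by (simp_all add: scaleC_unitization_def star_unitization_def)

lemma left_mult_scaleC: "left_mult (c *\<^sub>C x) a = c *\<^sub>C left_mult (x :: 'a unitization) a"
  by (simp add: left_mult_def algebra_simps scaleC_add_right scaleC_scaleC mult_scaleC_left)

lemma unitization_norm_scaleC: "norm (c *\<^sub>C x) = cmod c * norm (x :: 'a unitization)"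
proof -
  have le: "norm (c *\<^sub>C x) \<le> cmod c * norm x" for c and x :: "'a unitization"
    by (rule norm_unitization_leI)
      (simp_all add: norm_mult mult_left_mono scalar_part_le left_mult_scaleC norm_scaleC left_mult_le mult.assoc)
  show ?thesis
  proof (cases "c = 0")
    case True
    then show ?thesis using le[of 0 x] order_trans[OF norm_ge_zero scalar_part_le, of "c *\<^sub>C x"] by simp
  next
    case False
    have "inverse c *\<^sub>C c *\<^sub>C x = x"
      by (rule unitization.expand) (simp add: False scaleC_scaleC)
    then have "norm x \<le> cmod (inverse c) * norm (c *\<^sub>C x)"
      using le[of "inverse c" "c *\<^sub>C x"] by simp
    then show ?thesis
      using le[of c x] False by (simp add: norm_divide inverse_eq_divide pos_le_divide_eq mult.commute)
  qed
qed

lemma star_left_mult: "star (left_mult x a) * b = star a * left_mult (star (x :: 'a unitization)) b"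
  by (simp add: left_mult_def algebra_simps star_add star_mult star_scaleC mult_scaleC_left mult_scaleC_right)

text \<open>On the operator part,
  \<open>\<parallel>x a\<parallel>\<^sup>2 = \<parallel>a\<^sup>* (x\<^sup>* x) a\<parallel> \<le> \<parallel>x\<^sup>* x\<parallel> \<parallel>a\<parallel>\<^sup>2\<close> as in the algebra of operators on a Hilbert space.\<close>

lemma unitization_cstar_ineq: "(norm x)\<^sup>2 \<le> norm (star x * (x :: 'a unitization))"
proof -
  let ?n = "norm (star x * x)"
  have n: "?n \<ge> 0" by (rule order_trans[OF norm_ge_zero scalar_part_le])
  have "norm x \<le> sqrt ?n"
  proof (rule norm_unitization_leI)
    have "(cmod (scalar_part x))\<^sup>2 \<le> ?n"
      using scalar_part_le[of "star x * x"] by (simp add: norm_mult power2_eq_square)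
    then show "cmod (scalar_part x) \<le> sqrt ?n" by (rule real_le_rsqrt)
    fix a
    have "(norm (left_mult x a))\<^sup>2 = norm (star a * left_mult (star x * x) a)"
      by (simp add: left_mult_mult flip: cstar_identity star_left_mult)
    also have "\<dots> \<le> norm a * (?n * norm a)"
      by (rule order_trans[OF norm_mult_ineq]) (simp add: norm_star mult_left_mono left_mult_le)
    also have "\<dots> = (sqrt ?n * norm a)\<^sup>2"
      using n by (simp add: power_mult_distrib) (simp add: power2_eq_square)
    finally show "norm (left_mult x a) \<le> sqrt ?n * norm a"
      by (rule power2_le_imp_le) (use n in simp)
  qed
  then show ?thesis
    using n order_trans[OF norm_ge_zero scalar_part_le, of x] real_sqrt_pow2[OF n]
    by (metis power_mono)
qed

lemma unitization_star_star: "star (star x) = (x :: 'a unitization)"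
  by (rule unitization.expand) (simp add: star_star)

lemma unitization_cstar_identity: "norm (star x * x) = (norm (x :: 'a unitization))\<^sup>2"
proof -
  have nn: "norm y \<ge> 0" for y :: "'a unitization"
    by (rule order_trans[OF norm_ge_zero scalar_part_le])
  have *: "norm y \<le> norm (star y)" for y :: "'a unitization"
    using order_trans[OF unitization_cstar_ineq unitization_norm_mult, of y] nn[of y] nn[of "star y"]
    by (cases "norm y = 0") (auto simp: power2_eq_square)
  have "norm (star x) = norm x"
    using *[of x] *[of "star x"] by (simp add: unitization_star_star)
  then show ?thesis
    using unitization_cstar_ineq[of x] unitization_norm_mult[of "star x" x] by (simp add: power2_eq_square)
qed


instance
proof
  fix x y z :: "'a unitization" and r s :: real and c d :: complex
  show "c *\<^sub>C (x + y) = c *\<^sub>C x + c *\<^sub>C y" "(c + d) *\<^sub>C x = c *\<^sub>C x + d *\<^sub>C x"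
    "c *\<^sub>C d *\<^sub>C x = (c * d) *\<^sub>C x" "c *\<^sub>C x * y = c *\<^sub>C (x * y)" "x * c *\<^sub>C y = c *\<^sub>C (x * y)"
    "star (x + y) = star x + star y" "star (c *\<^sub>C x) = cnj c *\<^sub>C star x"
    "star (x * y) = star y * star x"
    by (rule unitization.expand; simp add: algebra_simps scaleC_add_left scaleC_add_right scaleC_scaleC
      mult_scaleC_left mult_scaleC_right star_add star_scaleC star_mult)+
  show "complex_of_real r *\<^sub>C x = r *\<^sub>R x"
    by (rule unitization.expand) (simp add: scaleC_of_real)
  show "norm (c *\<^sub>C x) = cmod c * norm x" by (rule unitization_norm_scaleC)
  show "norm (star x * x) = (norm x)\<^sup>2" by (rule unitization_cstar_identity)
  show "star (star x) = x" by (rule unitization_star_star)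
qed

end

instantiation unitization :: (cstar_algebra) unital_cstar_algebra
begin

definition "1 = Unitization 0 1"

instance
proof
  show "0 \<noteq> (1 :: 'a unitization)"
    by (simp add: zero_unitization_def one_unitization_def)
  show "1 * x = x" "x * 1 = x" for x :: "'a unitization"
    by (rule unitization.expand; simp add: one_unitization_def)+
  show "norm (1 :: 'a unitization) = 1"
  proof (rule antisym)
    show "norm (1 :: 'a unitization) \<le> 1"
      using norm_Unitization_le[of "0::'a" 1] by (simp add: one_unitization_def)
    show "1 \<le> norm (1 :: 'a unitization)"
      using scalar_part_le[of "1 :: 'a unitization"] by (simp add: one_unitization_def)
  qed
qed

end

section \<open>Sums of positive elements\<close>

text \<open>\<open>x + y = x y\<close> says that \<open>(1 - x) (1 - y) = 1\<close>; conversely, an inverse of \<open>1 - x\<close> necessarily has scalar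
  part \<open>1\<close>.\<close>

lemma quasi_invertible_iff_unitization:
  "quasi_invertible x \<longleftrightarrow> invertible_element (1 - Unitization (x :: 'a::cstar_algebra) 0)"
proof
  assume "quasi_invertible x"
  then obtain y where y: "x + y = x * y" "x + y = y * x"
    unfolding quasi_invertible_def by blast
  have "(1 - Unitization x 0) * (1 - Unitization y 0) = 1" "(1 - Unitization y 0) * (1 - Unitization x 0) = 1"
    using y by (auto intro!: unitization.expand simp: one_unitization_def algebra_simps)
  then show "invertible_element (1 - Unitization x 0)"
    unfolding invertible_element_def by blast
next
  assume "invertible_element (1 - Unitization x 0)"
  then obtain y where y: "(1 - Unitization x 0) * y = 1" "y * (1 - Unitization x 0) = 1"
    unfolding invertible_element_def by blast
  have s: "scalar_part y = 1"
    using arg_cong[OF y(1), of scalar_part] by (simp add: one_unitization_def)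
  have "x + - algebra_part y = x * - algebra_part y" "x + - algebra_part y = - algebra_part y * x"
    using arg_cong[OF y(1), of algebra_part] arg_cong[OF y(2), of algebra_part] s
    by (simp_all add: one_unitization_def algebra_simps scaleC_minus_left)
  then show "quasi_invertible x"
    unfolding quasi_invertible_def by blast
qed

lemma quasi_invertible_scaled_iff:
  fixes x :: "'a::cstar_algebra"
  assumes "z \<noteq> 0"
  shows "quasi_invertible (inverse z *\<^sub>C x) \<longleftrightarrow> invertible_element (z *\<^sub>C 1 - Unitization x 0)"
proof -
  have "z *\<^sub>C 1 - Unitization x 0 = z *\<^sub>C (1 - Unitization (inverse z *\<^sub>C x) 0)"
    by (rule unitization.expand) (simp add: assms one_unitization_def scaleC_minus_right scaleC_scaleC)
  then show ?thesis
    by (simp add: quasi_invertible_iff_unitization invertible_element_scaleC assms)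
qed

lemma positive_imp_invertible:
  fixes x :: "'a::cstar_algebra"
  assumes "positive x" "s > 0"
  shows "invertible_element (s *\<^sub>R 1 + Unitization x 0)"
proof -
  have z: "- complex_of_real s \<noteq> 0" "- complex_of_real s \<notin> \<real>\<^sub>\<ge>\<^sub>0"
    using assms(2) by (auto simp: complex_nonneg_Reals_iff)
  then have "quasi_invertible (inverse (- complex_of_real s) *\<^sub>C x)"
    using assms unfolding positive_def nonzero_spectrum_def by blast
  then have "invertible_element ((- complex_of_real s) *\<^sub>C 1 - Unitization x 0)"
    using quasi_invertible_scaled_iff[OF z(1)] by blast
  moreover have "s *\<^sub>R 1 + Unitization x 0 = (- 1) *\<^sub>R ((- complex_of_real s) *\<^sub>C 1 - Unitization x 0)"
    by (simp add: scaleC_minus_left scaleC_of_real)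
  ultimately show ?thesis
    by (simp only: invertible_element_scaleR[of "-1"])
qed

text \<open>Non-real values are excluded from the spectrum since \<open>x\<close> is self-adjoint, negative
  ones by the norm bound.\<close>

lemma positiveI:
  fixes x :: "'a::cstar_algebra"
  assumes sa: "star x = x" and t: "norm (t *\<^sub>R 1 - Unitization x 0) \<le> t"
  shows "positive x"
  unfolding positive_def
proof (intro conjI sa subsetI)
  fix z assume "z \<in> nonzero_spectrum x"
  then have z: "z \<noteq> 0" and ninv: "\<not> invertible_element (z *\<^sub>C 1 - Unitization x 0)"
    by (auto simp: nonzero_spectrum_def quasi_invertible_scaled_iff)
  have "star (Unitization x 0) = Unitization x 0"
    by (simp add: star_unitization_def sa)
  then have Im: "Im z = 0"
    using self_adjoint_real_spectrum ninv by blast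
  have "Re z \<ge> 0"
  proof (rule ccontr)
    assume "\<not> Re z \<ge> 0"
    then have "invertible_element ((- Re z) *\<^sub>R 1 + Unitization x 0)"
      by (intro invertible_pos_plus[OF t]) simp
    moreover have "z = of_real (Re z)" using Im by (simp add: complex_eq_iff)
    then have "z *\<^sub>C 1 - Unitization x 0 = (- 1) *\<^sub>R ((- Re z) *\<^sub>R 1 + Unitization x 0)"
      by (metis add.commute diff_minus_eq_add minus_diff_eq scaleC_of_real scaleR_minus1_left scaleR_minus_left uminus_add_conv_diff)
    ultimately show False
      using ninv invertible_element_scaleR[of "-1" "(- Re z) *\<^sub>R 1 + Unitization x 0"] by simp
  qed
  with Im show "z \<in> \<real>\<^sub>\<ge>\<^sub>0" by (simp add: complex_nonneg_Reals_iff)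
qed

lemma positive_imp_norm_le:
  fixes x :: "'a::cstar_algebra"
  assumes "positive x"
  shows "norm (norm x *\<^sub>R 1 - Unitization x 0) \<le> norm x"
  using assms positive_imp_invertible[OF assms]
  by (intro norm_scalar_minus_le) (simp_all add: star_unitization_def positive_def)

text \<open>In the form \<open>\<parallel>t - x\<parallel> \<le> t\<close>, positivity passes to sums by the triangle inequality.\<close>

theorem positive_add:
  fixes x y :: "'a::cstar_algebra"
  assumes "positive x" "positive y"
  shows "positive (x + y)"
proof (rule positiveI)
  show "star (x + y) = x + y" using assms by (simp add: positive_def star_add)
  have "Unitization (x + y) 0 = Unitization x 0 + Unitization y 0"
    by (simp add: plus_unitization_def)
  then show "norm ((norm x + norm y) *\<^sub>R 1 - Unitization (x + y) 0) \<le> norm x + norm y"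
    using norm_scalar_minus_add_le[OF assms[THEN positive_imp_norm_le]] by simp
qed

theorem norm_le_norm_add_positive:
  fixes x y :: "'a::cstar_algebra"
  assumes "positive x" "positive y"
  shows "norm x \<le> norm (x + y)"
proof -
  have "norm (Unitization x 0) \<le> norm (Unitization x 0 + Unitization y 0)"
    using assms positive_imp_invertible[OF assms(1)] positive_imp_invertible[OF assms(2)]
    by (intro norm_le_norm_add_unital) (simp_all add: star_unitization_def positive_def)
  then show ?thesis by (simp add: plus_unitization_def)
qed

section \<open>Pre-Hilbert modules\<close>

locale pre_hilbert =
  fixes E :: "('b::cstar_algebra, 'e) hilbert_module" (structure)
  assumes pre_hilbert: "pre_hilbert_module E"
begin

sublocale module complex_ring E
  using pre_hilbert unfolding pre_hilbert_module_def by blast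

lemma smult_in [simp, intro]: "x \<in> carrier E \<Longrightarrow> c \<odot>\<^bsub>E\<^esub> x \<in> carrier E"
  by (rule smult_closed) (simp add: complex_ring_def)

lemma act_closed [simp, intro]: "x \<in> carrier E \<Longrightarrow> act E x b \<in> carrier E"
  using pre_hilbert by (simp add: pre_hilbert_module_def)

lemma act_add_left: "\<lbrakk>x \<in> carrier E; y \<in> carrier E\<rbrakk> \<Longrightarrow> act E (x \<oplus> y) b = act E x b \<oplus> act E y b"
  using pre_hilbert by (simp add: pre_hilbert_module_def)

lemma hinner_add_right:
  "\<lbrakk>x \<in> carrier E; y \<in> carrier E; z \<in> carrier E\<rbrakk> \<Longrightarrow> hinner E x (y \<oplus> z) = hinner E x y + hinner E x z"
  using pre_hilbert by (simp add: pre_hilbert_module_def)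

lemma hinner_act_right:
  "\<lbrakk>x \<in> carrier E; y \<in> carrier E\<rbrakk> \<Longrightarrow> hinner E x (act E y b) = hinner E x y * b"
  using pre_hilbert by (simp add: pre_hilbert_module_def)

lemma star_hinner: "\<lbrakk>x \<in> carrier E; y \<in> carrier E\<rbrakk> \<Longrightarrow> star (hinner E x y) = hinner E y x"
  using pre_hilbert by (simp add: pre_hilbert_module_def)

lemma positive_hinner: "x \<in> carrier E \<Longrightarrow> positive (hinner E x x)"
  using pre_hilbert by (simp add: pre_hilbert_module_def)

lemma hinner_definite: "\<lbrakk>x \<in> carrier E; hinner E x x = 0\<rbrakk> \<Longrightarrow> x = \<zero>"
  using pre_hilbert by (simp add: pre_hilbert_module_def)

lemma hinner_zero_right [simp]: "x \<in> carrier E \<Longrightarrow> hinner E x \<zero> = 0"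
  using hinner_add_right[of x \<zero> \<zero>] by simp

lemma hinner_zero_left [simp]: "x \<in> carrier E \<Longrightarrow> hinner E \<zero> x = 0"
  using star_hinner[of x \<zero>] by simp

lemma hinner_minus_right: "\<lbrakk>x \<in> carrier E; y \<in> carrier E\<rbrakk> \<Longrightarrow> hinner E x (\<ominus> y) = - hinner E x y"
  using hinner_add_right[of x "\<ominus> y" y] by (simp add: l_neg eq_neg_iff_add_eq_0)

lemma hinner_diff_right:
  "\<lbrakk>x \<in> carrier E; y \<in> carrier E; z \<in> carrier E\<rbrakk> \<Longrightarrow> hinner E x (y \<ominus> z) = hinner E x y - hinner E x z"
  by (simp add: a_minus_def hinner_add_right hinner_minus_right)

lemma hinner_diff_left:
  assumes "x \<in> carrier E" "y \<in> carrier E" "z \<in> carrier E"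
  shows "hinner E (x \<ominus> y) z = hinner E x z - hinner E y z"
proof -
  have "hinner E (x \<ominus> y) z = star (hinner E z (x \<ominus> y))"
    using assms by (simp add: star_hinner)
  also have "\<dots> = star (hinner E z x) - star (hinner E z y)"
    using assms by (simp add: hinner_diff_right star_diff)
  finally show ?thesis using assms by (simp add: star_hinner)
qed

lemma act_zero [simp]: "act E \<zero> b = \<zero>"
proof -
  have "act E \<zero> b \<oplus> act E \<zero> b = act E \<zero> b"
    using act_add_left[of \<zero> \<zero> b] by simp
  then show ?thesis using add.l_cancel_one[of "act E \<zero> b" "act E \<zero> b"] by simp
qed

lemma hnorm_nonneg [simp]: "0 \<le> hnorm E x"
  by (simp add: hnorm_def)

lemma eq_if_diff_zero:
  assumes "x \<ominus> y = \<zero>" "x \<in> carrier E" "y \<in> carrier E"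
  shows "x = y"
proof -
  have "\<ominus> (\<ominus> y) = x"
    using assms by (intro minus_equality) (simp_all add: a_minus_def)
  then show ?thesis using assms by simp
qed

lemma hinner_eqI:
  assumes xy: "x \<in> carrier E" "y \<in> carrier E"
    and eq: "\<And>z. z \<in> carrier E \<Longrightarrow> hinner E z x = hinner E z y"
  shows "x = y"
proof -
  have "hinner E (x \<ominus> y) (x \<ominus> y) = 0"
    using xy eq[of "x \<ominus> y"] by (simp add: hinner_diff_right)
  then have "x \<ominus> y = \<zero>" using xy by (intro hinner_definite) simp_all
  then show ?thesis using xy by (rule eq_if_diff_zero)
qed

text \<open>For \<open>z\<close> orthogonal to \<open>s\<close> one has \<open>\<langle>z - s, z - s\<rangle> = \<langle>z, z\<rangle> + \<langle>s, s\<rangle>\<close>, a sum of positive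
  elements, so \<open>\<parallel>z\<parallel> \<le> \<parallel>z - s\<parallel>\<close>.  Hence an element \<open>z\<close> orthogonal to a dense set is \<open>0\<close>.\<close>

lemma hinner_eqI_dense:
  assumes xy: "x \<in> carrier E" "y \<in> carrier E" and S: "hdense E S"
    and eq: "\<And>s. s \<in> S \<Longrightarrow> hinner E s x = hinner E s y"
  shows "x = y"
proof -
  define z where "z = x \<ominus> y"
  have z: "z \<in> carrier E" using xy by (simp add: z_def)
  have "hnorm E z < \<epsilon>" if \<epsilon>: "\<epsilon> > 0" for \<epsilon>
  proof -
    obtain s where s: "s \<in> S" "hnorm E (z \<ominus> s) < \<epsilon>"
      using S z \<epsilon> unfolding hdense_def by blast
    have sc: "s \<in> carrier E" using S s(1) by (auto simp: hdense_def)
    have sz: "hinner E s z = 0"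
      using eq[OF s(1)] xy sc by (simp add: z_def hinner_diff_right)
    then have "hinner E z s = 0" using star_hinner[of s z] sc z by simp
    then have "hinner E (z \<ominus> s) (z \<ominus> s) = hinner E z z + hinner E s s"
      using sc z sz by (simp add: hinner_diff_right hinner_diff_left)
    then have "hnorm E z \<le> hnorm E (z \<ominus> s)"
      using norm_le_norm_add_positive[OF positive_hinner[OF z] positive_hinner[OF sc]]
      by (simp add: hnorm_def)
    then show ?thesis using s(2) by simp
  qed
  from this[of "hnorm E z"] have "hnorm E z = 0"
    using hnorm_nonneg[of z] by linarith
  then have "z = \<zero>" using z by (intro hinner_definite) (simp_all add: hnorm_def)
  then have "x \<ominus> y = \<zero>" by (simp only: z_def)
  then show ?thesis using xy by (rule eq_if_diff_zero)
qed

lemma is_adjoint_adj: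
  assumes "T \<in> adjointable E"
  shows "is_adjoint E T (adj E T)"
proof -
  have "\<exists>S. is_adjoint E T S" using assms unfolding adjointable_def by blast
  then have "is_adjoint E T (Eps (is_adjoint E T))" by (rule someI_ex[of "is_adjoint E T"])
  then show ?thesis unfolding adj_def .
qed

lemma adjoint_unique:
  assumes "is_adjoint E T S" "is_adjoint E T S'" "x \<in> carrier E"
  shows "S x = S' x"
proof (rule hinner_eqI)
  show "S x \<in> carrier E" "S' x \<in> carrier E" using assms by (auto simp: is_adjoint_def)
  show "hinner E z (S x) = hinner E z (S' x)" if "z \<in> carrier E" for z
    using assms that unfolding is_adjoint_def by metis
qed

lemma adj_eq:
  assumes "T \<in> adjointable E" "is_adjoint E T S" "x \<in> carrier E"
  shows "adj E T x = S x"
  using adjoint_unique[OF is_adjoint_adj[OF assms(1)] assms(2,3)] .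

lemma finsum_Suc_lessThan:
  assumes "\<And>i. i < Suc n \<Longrightarrow> f i \<in> carrier E"
  shows "(\<Oplus>i\<in>{..<Suc n}. f i) = (\<Oplus>i\<in>{..<n}. f i) \<oplus> f n"
  using assms by (simp add: lessThan_Suc finsum_insert Pi_iff a_comm)

lemma finsum_append:
  fixes n m :: nat
  assumes f: "\<And>i. i < n \<Longrightarrow> f i \<in> carrier E" and g: "\<And>i. i < m \<Longrightarrow> g i \<in> carrier E"
  shows "(\<Oplus>i\<in>{..<n}. f i) \<oplus> (\<Oplus>i\<in>{..<m}. g i) = (\<Oplus>i\<in>{..<n + m}. if i < n then f i else g (i - n))"
  using g
proof (induction m)
  case 0
  have "(\<Oplus>i\<in>{..<n}. f i) = (\<Oplus>i\<in>{..<n}. if i < n then f i else g (i - n))"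
    using f by (intro finsum_cong) (auto simp: simp_implies_def)
  then show ?case using f by (simp add: finsum_closed Pi_iff)
next
  case (Suc m)
  have "(\<Oplus>i\<in>{..<n}. f i) \<oplus> (\<Oplus>i\<in>{..<Suc m}. g i) = ((\<Oplus>i\<in>{..<n}. f i) \<oplus> (\<Oplus>i\<in>{..<m}. g i)) \<oplus> g m"
    using f Suc.prems by (simp add: finsum_Suc_lessThan a_assoc finsum_closed Pi_iff)
  also have "\<dots> = (\<Oplus>i\<in>{..<n + Suc m}. if i < n then f i else g (i - n))"
    using f Suc.prems by (simp add: Suc.IH finsum_Suc_lessThan)
  finally show ?case .
qed

end

lemma additive_zero:
  assumes "abelian_group E" "abelian_group F" "U \<in> carrier E \<rightarrow> carrier F"
    and "\<And>x y. \<lbrakk>x \<in> carrier E; y \<in> carrier E\<rbrakk> \<Longrightarrow> U (x \<oplus>\<^bsub>E\<^esub> y) = U x \<oplus>\<^bsub>F\<^esub> U y"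
  shows "U \<zero>\<^bsub>E\<^esub> = \<zero>\<^bsub>F\<^esub>"
proof -
  interpret E: abelian_group E by fact
  interpret F: abelian_group F by fact
  have "U \<zero>\<^bsub>E\<^esub> \<in> carrier F" using assms(3) by auto
  then show ?thesis
    using assms(4)[of "\<zero>\<^bsub>E\<^esub>" "\<zero>\<^bsub>E\<^esub>"] F.add.l_cancel_one[of "U \<zero>\<^bsub>E\<^esub>" "U \<zero>\<^bsub>E\<^esub>"] by simp
qed

lemma additive_finsum:
  assumes "abelian_group E" "abelian_group F" "U \<in> carrier E \<rightarrow> carrier F"
    and add: "\<And>x y. \<lbrakk>x \<in> carrier E; y \<in> carrier E\<rbrakk> \<Longrightarrow> U (x \<oplus>\<^bsub>E\<^esub> y) = U x \<oplus>\<^bsub>F\<^esub> U y"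
    and f: "\<And>i. i \<in> I \<Longrightarrow> f i \<in> carrier E" and I: "finite I"
  shows "U (\<Oplus>\<^bsub>E\<^esub>i\<in>I. f i) = (\<Oplus>\<^bsub>F\<^esub>i\<in>I. U (f i))"
proof -
  interpret E: abelian_group E by fact
  interpret F: abelian_group F by fact
  show ?thesis
    using I f
  proof (induction rule: finite_induct)
    case empty
    then show ?case using additive_zero[OF assms(1-4)] by simp
  next
    case (insert i I)
    then have "f \<in> I \<rightarrow> carrier E" "(\<lambda>i. U (f i)) \<in> I \<rightarrow> carrier F" "f i \<in> carrier E" "U (f i) \<in> carrier F"
      using assms(3) by auto
    then show ?case
      using insert by (simp add: E.finsum_insert F.finsum_insert add E.finsum_closed)
  qed
qed

text \<open>Operators are functions on the whole ambient type, so membership in operator spaces has to be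
  transferred between functions that agree on the carrier only.\<close>

lemma op_closure_cong:
  assumes T: "T \<in> op_closure E W" and eq: "\<And>x. x \<in> carrier E \<Longrightarrow> T' x = T x"
  shows "T' \<in> op_closure E W"
proof -
  have "is_adjoint E T' S \<longleftrightarrow> is_adjoint E T S" for S
    using eq by (simp add: is_adjoint_def)
  then have "T' \<in> adjointable E"
    using T eq by (auto simp: op_closure_def adjointable_def)
  then show ?thesis
    using T eq by (simp add: op_closure_def)
qed

section \<open>Direct sums of Hilbert modules\<close>

locale pre_hilbert_pair = E: pre_hilbert E + F: pre_hilbert F
  for E :: "('b::cstar_algebra, 'e) hilbert_module" and F :: "('b, 'f) hilbert_module"
begin

abbreviation M :: "('b, 'e \<times> 'f) hilbert_module" where "M \<equiv> module_sum E F"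

lemma module_sum_simps [simp]:
  "carrier M = carrier E \<times> carrier F" "\<zero>\<^bsub>M\<^esub> = (\<zero>\<^bsub>E\<^esub>, \<zero>\<^bsub>F\<^esub>)"
  "(x, y) \<oplus>\<^bsub>M\<^esub> (x', y') = (x \<oplus>\<^bsub>E\<^esub> x', y \<oplus>\<^bsub>F\<^esub> y')"
  "c \<odot>\<^bsub>M\<^esub> (x, y) = (c \<odot>\<^bsub>E\<^esub> x, c \<odot>\<^bsub>F\<^esub> y)"
  "act M (x, y) b = (act E x b, act F y b)"
  "hinner M (x, y) (x', y') = hinner E x x' + hinner F y y'"
  "hgrade M (x, y) = (hgrade E x, hgrade F y)"
  by (simp_all add: module_sum_def)

lemma abelian_group_sum: "abelian_group M"
proof (rule abelian_groupI)
  fix z assume "z \<in> carrier M"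
  then show "\<exists>w\<in>carrier M. w \<oplus>\<^bsub>M\<^esub> z = \<zero>\<^bsub>M\<^esub>"
    by (intro bexI[of _ "(\<ominus>\<^bsub>E\<^esub> fst z, \<ominus>\<^bsub>F\<^esub> snd z)"]) (auto simp: E.l_neg F.l_neg)
qed (auto simp: E.a_assoc F.a_assoc intro: E.a_comm F.a_comm)

lemma module_sum: "module complex_ring M"
proof (rule moduleI)
  show "cring complex_ring" by (rule E.R.is_cring)
qed (auto simp: abelian_group_sum E.smult_l_distr F.smult_l_distr E.smult_r_distr F.smult_r_distr
      E.smult_assoc1 F.smult_assoc1)

text \<open>For positive \<open>p\<close>, \<open>q\<close> with \<open>p + q = 0\<close>, the bound \<open>\<parallel>p\<parallel> \<le> \<parallel>p + q\<parallel>\<close> gives \<open>p = 0\<close>.\<close>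

lemma hinner_sum_definite:
  assumes "x \<in> carrier E" "y \<in> carrier F" "hinner E x x + hinner F y y = 0"
  shows "x = \<zero>\<^bsub>E\<^esub>" "y = \<zero>\<^bsub>F\<^esub>"
proof -
  have "norm (hinner E x x) \<le> 0" "norm (hinner F y y) \<le> 0"
    using norm_le_norm_add_positive[of "hinner E x x" "hinner F y y"]
      norm_le_norm_add_positive[of "hinner F y y" "hinner E x x"] assms
    by (simp_all add: E.positive_hinner F.positive_hinner add.commute)
  then show "x = \<zero>\<^bsub>E\<^esub>" "y = \<zero>\<^bsub>F\<^esub>"
    using assms E.hinner_definite F.hinner_definite by auto
qed

lemma pre_hilbert_module_sum: "pre_hilbert_module M"
  using E.pre_hilbert F.pre_hilbert
  by (auto simp: pre_hilbert_module_def module_sum scaleC_add_right distrib_right star_add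
      intro!: positive_add dest: hinner_sum_definite)

sublocale M: pre_hilbert M
  by unfold_locales (rule pre_hilbert_module_sum)

lemma minus_sum [simp]:
  "\<lbrakk>x \<in> carrier E; y \<in> carrier F\<rbrakk> \<Longrightarrow> \<ominus>\<^bsub>M\<^esub> (x, y) = (\<ominus>\<^bsub>E\<^esub> x, \<ominus>\<^bsub>F\<^esub> y)"
  by (rule M.minus_equality) (auto simp: E.l_neg F.l_neg)

lemma diff_sum [simp]:
  "\<lbrakk>x' \<in> carrier E; y' \<in> carrier F\<rbrakk> \<Longrightarrow> (x, y) \<ominus>\<^bsub>M\<^esub> (x', y') = (x \<ominus>\<^bsub>E\<^esub> x', y \<ominus>\<^bsub>F\<^esub> y')"
  by (simp add: a_minus_def)

lemma hnorm_sum_le: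
  "hnorm M (x, y) \<le> hnorm E x + hnorm F y"
proof -
  have "norm (hinner E x x + hinner F y y) \<le> norm (hinner E x x) + norm (hinner F y y)"
    by (rule norm_triangle_ineq)
  then show ?thesis
    unfolding hnorm_def by (simp add: order_trans[OF real_sqrt_le_mono sqrt_add_le_add_sqrt])
qed

lemma hnorm_le_sum:
  assumes "x \<in> carrier E" "y \<in> carrier F"
  shows "hnorm E x \<le> hnorm M (x, y)" "hnorm F y \<le> hnorm M (x, y)"
  using assms norm_le_norm_add_positive[of "hinner E x x" "hinner F y y"]
      norm_le_norm_add_positive[of "hinner F y y" "hinner E x x"]
  by (simp_all add: hnorm_def E.positive_hinner F.positive_hinner add.commute)

lemma hconverges_sum_iff:
  assumes "\<And>n. X n \<in> carrier E" "\<And>n. Y n \<in> carrier F" "x \<in> carrier E" "y \<in> carrier F"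
  shows "hconverges M (\<lambda>n. (X n, Y n)) (x, y) \<longleftrightarrow> hconverges E X x \<and> hconverges F Y y"
proof
  assume *: "hconverges M (\<lambda>n. (X n, Y n)) (x, y)"
  show "hconverges E X x \<and> hconverges F Y y"
    unfolding hconverges_def
    by (intro conjI Lim_null_comparison[OF _ *[unfolded hconverges_def]])
      (use assms hnorm_le_sum in simp_all)
next
  assume *: "hconverges E X x \<and> hconverges F Y y"
  have "(\<lambda>n. hnorm E (X n \<ominus>\<^bsub>E\<^esub> x) + hnorm F (Y n \<ominus>\<^bsub>F\<^esub> y)) \<longlonglongrightarrow> 0"
    using * by (intro tendsto_add_zero) (simp_all add: hconverges_def)
  then show "hconverges M (\<lambda>n. (X n, Y n)) (x, y)"
    unfolding hconverges_def
    by (rule Lim_null_comparison[rotated]) (use assms hnorm_sum_le in simp)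
qed

lemma hilbert_module_sum:
  assumes "hilbert_module E" "hilbert_module F"
  shows "hilbert_module M"
  unfolding hilbert_module_def
proof (intro conjI allI impI pre_hilbert_module_sum)
  fix Z assume Z: "(\<forall>n. Z n \<in> carrier M) \<and> hCauchy M Z"
  define X Y where "X n = fst (Z n)" and "Y n = snd (Z n)" for n
  have XY: "X n \<in> carrier E" "Y n \<in> carrier F" "Z = (\<lambda>n. (X n, Y n))" for n
    using Z by (auto simp: X_def Y_def mem_Times_iff)
  have *: "hnorm E (X m \<ominus>\<^bsub>E\<^esub> X n) \<le> hnorm M (Z m \<ominus>\<^bsub>M\<^esub> Z n)"
    "hnorm F (Y m \<ominus>\<^bsub>F\<^esub> Y n) \<le> hnorm M (Z m \<ominus>\<^bsub>M\<^esub> Z n)" for m n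
    using XY(1,2) hnorm_le_sum by (simp_all add: XY(3))
  have "hCauchy E X" "hCauchy F Y"
    using Z * unfolding hCauchy_def by (meson le_less_trans)+
  then obtain x y where "x \<in> carrier E" "hconverges E X x" "y \<in> carrier F" "hconverges F Y y"
    using assms XY unfolding hilbert_module_def by meson
  then show "\<exists>z\<in>carrier M. hconverges M Z z"
    using hconverges_sum_iff[of X Y x y] XY by (intro bexI[of _ "(x, y)"]) simp_all
qed

lemma hdense_sum:
  assumes "hdense E S" "hdense F S'" "S \<times> S' \<subseteq> S''" "S'' \<subseteq> carrier M"
  shows "hdense M S''"
  unfolding hdense_def
proof (intro conjI ballI allI impI assms(4))
  fix z and \<epsilon> :: real assume "z \<in> carrier M" and \<epsilon>: "0 < \<epsilon>"
  then obtain x y where z: "z = (x, y)" "x \<in> carrier E" "y \<in> carrier F" by auto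
  obtain s s' where s: "s \<in> S" "hnorm E (x \<ominus>\<^bsub>E\<^esub> s) < \<epsilon>/2" "s' \<in> S'" "hnorm F (y \<ominus>\<^bsub>F\<^esub> s') < \<epsilon>/2"
    using assms(1,2) z \<epsilon> unfolding hdense_def by (meson half_gt_zero)
  then have "s \<in> carrier E" "s' \<in> carrier F" using assms(1,2) by (auto simp: hdense_def)
  then have "hnorm M (z \<ominus>\<^bsub>M\<^esub> (s, s')) < \<epsilon>"
    using hnorm_sum_le[of "x \<ominus>\<^bsub>E\<^esub> s" "y \<ominus>\<^bsub>F\<^esub> s'"] s by (simp add: z)
  then show "\<exists>s\<in>S''. hnorm M (z \<ominus>\<^bsub>M\<^esub> s) < \<epsilon>" using s assms(3) by blast
qed

lemma finsum_inl:
  assumes "\<And>i. i \<in> I \<Longrightarrow> f i \<in> carrier E" "finite I"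
  shows "(\<Oplus>\<^bsub>M\<^esub>i\<in>I. (f i, \<zero>\<^bsub>F\<^esub>)) = (\<Oplus>\<^bsub>E\<^esub>i\<in>I. f i, \<zero>\<^bsub>F\<^esub>)"
  by (rule additive_finsum[of E M "\<lambda>x. (x, \<zero>\<^bsub>F\<^esub>)", symmetric])
    (auto simp: assms abelian_group_sum E.abelian_group_axioms)

lemma finsum_inr:
  assumes "\<And>i. i \<in> I \<Longrightarrow> f i \<in> carrier F" "finite I"
  shows "(\<Oplus>\<^bsub>M\<^esub>i\<in>I. (\<zero>\<^bsub>E\<^esub>, f i)) = (\<zero>\<^bsub>E\<^esub>, \<Oplus>\<^bsub>F\<^esub>i\<in>I. f i)"
  by (rule additive_finsum[of F M "\<lambda>x. (\<zero>\<^bsub>E\<^esub>, x)", symmetric])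
    (auto simp: assms abelian_group_sum F.abelian_group_axioms)

text \<open>The concatenation combines families of different lengths; it serves both for combinations of
  generators and for finite-rank operators.\<close>

lemma finsum_sum_append:
  fixes n m :: nat
  assumes "\<And>i. i < n \<Longrightarrow> f i \<in> carrier E" "\<And>i. i < m \<Longrightarrow> g i \<in> carrier F"
  shows "(\<Oplus>\<^bsub>E\<^esub>i\<in>{..<n}. f i, \<Oplus>\<^bsub>F\<^esub>i\<in>{..<m}. g i) =
    (\<Oplus>\<^bsub>M\<^esub>i\<in>{..<n + m}. if i < n then (f i, \<zero>\<^bsub>F\<^esub>) else (\<zero>\<^bsub>E\<^esub>, g (i - n)))"
proof -
  have "(\<Oplus>\<^bsub>M\<^esub>i\<in>{..<n + m}. if i < n then (f i, \<zero>\<^bsub>F\<^esub>) else (\<zero>\<^bsub>E\<^esub>, g (i - n)))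
    = (\<Oplus>\<^bsub>M\<^esub>i\<in>{..<n}. (f i, \<zero>\<^bsub>F\<^esub>)) \<oplus>\<^bsub>M\<^esub> (\<Oplus>\<^bsub>M\<^esub>i\<in>{..<m}. (\<zero>\<^bsub>E\<^esub>, g i))"
    using assms by (intro M.finsum_append[symmetric]) auto
  moreover have "(\<Oplus>\<^bsub>M\<^esub>i\<in>{..<n}. (f i, \<zero>\<^bsub>F\<^esub>)) = (\<Oplus>\<^bsub>E\<^esub>i\<in>{..<n}. f i, \<zero>\<^bsub>F\<^esub>)"
    using assms by (intro finsum_inl) auto
  moreover have "(\<Oplus>\<^bsub>M\<^esub>i\<in>{..<m}. (\<zero>\<^bsub>E\<^esub>, g i)) = (\<zero>\<^bsub>E\<^esub>, \<Oplus>\<^bsub>F\<^esub>i\<in>{..<m}. g i)"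
    using assms by (intro finsum_inr) auto
  ultimately show ?thesis
    using assms by (simp add: E.finsum_closed F.finsum_closed Pi_iff)
qed

lemma countably_generated_sum:
  assumes "countably_generated E" "countably_generated F"
  shows "countably_generated M"
proof -
  define S where "S G = {(\<Oplus>\<^bsub>E\<^esub>i\<in>{..<n}. act E (g i) (b i)) | (n::nat) g b. \<forall>i<n. g i \<in> G}" for G
  define S' where "S' G = {(\<Oplus>\<^bsub>F\<^esub>i\<in>{..<n}. act F (g i) (b i)) | (n::nat) g b. \<forall>i<n. g i \<in> G}" for G
  obtain G H where G: "G \<subseteq> carrier E" "countable G" "hdense E (S G)"
    and H: "H \<subseteq> carrier F" "countable H" "hdense F (S' H)"
    using assms unfolding countably_generated_def S_def S'_def by blast
  define K where "K = (\<lambda>x. (x, \<zero>\<^bsub>F\<^esub>)) ` G \<union> (\<lambda>x. (\<zero>\<^bsub>E\<^esub>, x)) ` H"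
  have K: "K \<subseteq> carrier M" "countable K" using G H by (auto simp: K_def)
  have "hdense M {(\<Oplus>\<^bsub>M\<^esub>i\<in>{..<n}. act M (g i) (b i)) | (n::nat) g b. \<forall>i<n. g i \<in> K}"
  proof (rule hdense_sum[OF G(3) H(3)])
    show "S G \<times> S' H \<subseteq> {(\<Oplus>\<^bsub>M\<^esub>i\<in>{..<n}. act M (g i) (b i)) | (n::nat) g b. \<forall>i<n. g i \<in> K}"
    proof safe
      fix s s' assume "s \<in> S G" "s' \<in> S' H"
      then obtain n g b m h c where s: "s = (\<Oplus>\<^bsub>E\<^esub>i\<in>{..<n}. act E (g i) (b i))" "\<And>i. i < (n::nat) \<Longrightarrow> g i \<in> G"
        and s': "s' = (\<Oplus>\<^bsub>F\<^esub>i\<in>{..<m}. act F (h i) (c i))" "\<And>i. i < (m::nat) \<Longrightarrow> h i \<in> H"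
        unfolding S_def S'_def by blast
      have "\<And>i. i < n \<Longrightarrow> g i \<in> carrier E" "\<And>i. i < m \<Longrightarrow> h i \<in> carrier F"
        using s(2) s'(2) G(1) H(1) by blast+
      note gh = this
      define k where "k i = (if i < n then (g i, \<zero>\<^bsub>F\<^esub>) else (\<zero>\<^bsub>E\<^esub>, h (i - n)))" for i
      define d where "d i = (if i < n then b i else c (i - n))" for i
      have 1: "\<forall>i<n + m. k i \<in> K"
        using s(2) s'(2) by (auto simp: k_def K_def)
      have "(s, s') = (\<Oplus>\<^bsub>M\<^esub>i\<in>{..<n + m}. if i < n then (act E (g i) (b i), \<zero>\<^bsub>F\<^esub>) else (\<zero>\<^bsub>E\<^esub>, act F (h (i - n)) (c (i - n))))"
        unfolding s(1) s'(1) using gh by (intro finsum_sum_append) auto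
      also have "\<dots> = (\<Oplus>\<^bsub>M\<^esub>i\<in>{..<n + m}. act M (k i) (d i))"
        by (rule arg_cong[where f = "\<lambda>f. finsum M f _"]) (auto simp: k_def d_def fun_eq_iff)
      finally show "\<exists>n g b. (s, s') = (\<Oplus>\<^bsub>M\<^esub>i\<in>{..<n}. act M (g i) (b i)) \<and> (\<forall>i<(n::nat). g i \<in> K)"
        using 1 by blast
    qed
    show "{(\<Oplus>\<^bsub>M\<^esub>i\<in>{..<n}. act M (g i) (b i)) | (n::nat) g b. \<forall>i<n. g i \<in> K} \<subseteq> carrier M"
    proof clarify
      fix x y n g b assume "(x, y) = (\<Oplus>\<^bsub>M\<^esub>i\<in>{..<n}. act M (g i) (b i))" "\<forall>i<(n::nat). g i \<in> K"
      moreover have "(\<lambda>i. act M (g i) (b i)) \<in> {..<n} \<rightarrow> carrier M"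
        using calculation(2) K(1) by (intro Pi_I M.act_closed) blast
      ultimately show "(x, y) \<in> carrier M" by (simp only: M.finsum_closed)
    qed
  qed
  then show ?thesis using K unfolding countably_generated_def by blast
qed

section \<open>Adjointable and compact operators on a direct sum\<close>

lemma is_adjoint_sum:
  assumes "is_adjoint E T S" "is_adjoint F T' S'"
  shows "is_adjoint M (map_prod T T') (map_prod S S')"
  using assms by (auto simp: is_adjoint_def)

lemma adjointable_sum:
  assumes "T \<in> adjointable E" "T' \<in> adjointable F"
  shows "map_prod T T' \<in> adjointable M"
  using assms is_adjoint_sum unfolding adjointable_def by fastforce

lemma adj_sum:
  assumes "T \<in> adjointable E" "T' \<in> adjointable F" "z \<in> carrier M"
  shows "adj M (map_prod T T') z = map_prod (adj E T) (adj F T') z"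
  using assms adjointable_sum[OF assms(1,2)]
  by (intro M.adj_eq is_adjoint_sum E.is_adjoint_adj F.is_adjoint_adj)

lemma op_closure_sum:
  assumes T: "T \<in> op_closure E W" "T' \<in> op_closure F W'"
    and W: "W \<subseteq> carrier E \<rightarrow> carrier E" "W' \<subseteq> carrier F \<rightarrow> carrier F"
    and sum: "\<And>S S'. \<lbrakk>S \<in> W; S' \<in> W'\<rbrakk> \<Longrightarrow> map_prod S S' \<in> W''"
  shows "map_prod T T' \<in> op_closure M W''"
  unfolding op_closure_def
proof (intro CollectI conjI allI impI)
  show "map_prod T T' \<in> adjointable M"
    using T by (intro adjointable_sum) (auto simp: op_closure_def)
  fix \<epsilon> :: real assume "\<epsilon> > 0"
  then obtain S S' where S: "S \<in> W" "\<And>x. x \<in> carrier E \<Longrightarrow> hnorm E (T x \<ominus>\<^bsub>E\<^esub> S x) \<le> \<epsilon>/2 * hnorm E x"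
    and S': "S' \<in> W'" "\<And>x. x \<in> carrier F \<Longrightarrow> hnorm F (T' x \<ominus>\<^bsub>F\<^esub> S' x) \<le> \<epsilon>/2 * hnorm F x"
    using T unfolding op_closure_def by (smt (verit) half_gt_zero mem_Collect_eq)
  show "\<exists>S\<in>W''. \<forall>z\<in>carrier M. hnorm M (map_prod T T' z \<ominus>\<^bsub>M\<^esub> S z) \<le> \<epsilon> * hnorm M z"
  proof (intro bexI[OF _ sum[OF S(1) S'(1)]] ballI)
    fix z assume "z \<in> carrier M"
    then obtain x y where z: "z = (x, y)" "x \<in> carrier E" "y \<in> carrier F" by auto
    have "S x \<in> carrier E" "S' y \<in> carrier F" using W S(1) S'(1) z by auto
    then have "hnorm M (map_prod T T' z \<ominus>\<^bsub>M\<^esub> map_prod S S' z)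
        \<le> hnorm E (T x \<ominus>\<^bsub>E\<^esub> S x) + hnorm F (T' y \<ominus>\<^bsub>F\<^esub> S' y)"
      using hnorm_sum_le by (simp add: z)
    also have "\<dots> \<le> \<epsilon>/2 * hnorm E x + \<epsilon>/2 * hnorm F y"
      using S S' z by (intro add_mono) auto
    also have "\<dots> \<le> \<epsilon>/2 * hnorm M z + \<epsilon>/2 * hnorm M z"
      using \<open>\<epsilon> > 0\<close> z hnorm_le_sum by (intro add_mono mult_left_mono) auto
    finally show "hnorm M (map_prod T T' z \<ominus>\<^bsub>M\<^esub> map_prod S S' z) \<le> \<epsilon> * hnorm M z"
      by simp
  qed
qed

lemma finite_rank_sum:
  assumes "T \<in> finite_rank E" "T' \<in> finite_rank F"
  shows "map_prod T T' \<in> finite_rank M"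
proof -
  obtain n f g where T: "\<And>i. f i \<in> carrier E" "\<And>i. g i \<in> carrier E"
    "\<And>x. x \<in> carrier E \<Longrightarrow> T x = (\<Oplus>\<^bsub>E\<^esub>i\<in>{..<n::nat}. act E (f i) (hinner E (g i) x))"
    using assms(1) unfolding finite_rank_def by blast
  obtain m f' g' where T': "\<And>i. f' i \<in> carrier F" "\<And>i. g' i \<in> carrier F"
    "\<And>x. x \<in> carrier F \<Longrightarrow> T' x = (\<Oplus>\<^bsub>F\<^esub>i\<in>{..<m::nat}. act F (f' i) (hinner F (g' i) x))"
    using assms(2) unfolding finite_rank_def by blast
  define h where "h i = (if i < n then (f i, \<zero>\<^bsub>F\<^esub>) else (\<zero>\<^bsub>E\<^esub>, f' (i - n)))" for i
  define k where "k i = (if i < n then (g i, \<zero>\<^bsub>F\<^esub>) else (\<zero>\<^bsub>E\<^esub>, g' (i - n)))" for i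
  have "map_prod T T' z = (\<Oplus>\<^bsub>M\<^esub>i\<in>{..<n + m}. act M (h i) (hinner M (k i) z))" if "z \<in> carrier M" for z
  proof -
    obtain x y where z: "z = (x, y)" "x \<in> carrier E" "y \<in> carrier F" using \<open>z \<in> carrier M\<close> by auto
    have "map_prod T T' z = (\<Oplus>\<^bsub>M\<^esub>i\<in>{..<n + m}. if i < n then (act E (f i) (hinner E (g i) x), \<zero>\<^bsub>F\<^esub>)
        else (\<zero>\<^bsub>E\<^esub>, act F (f' (i - n)) (hinner F (g' (i - n)) y)))"
      unfolding z(1) map_prod_simp T(3)[OF z(2)] T'(3)[OF z(3)]
      using T T' by (intro finsum_sum_append) auto
    also have "\<dots> = (\<Oplus>\<^bsub>M\<^esub>i\<in>{..<n + m}. act M (h i) (hinner M (k i) z))"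
      by (rule arg_cong[where f = "\<lambda>f. finsum M f _"]) (auto simp: h_def k_def fun_eq_iff z)
    finally show ?thesis .
  qed
  moreover have "h i \<in> carrier M" "k i \<in> carrier M" for i
    using T T' by (auto simp: h_def k_def)
  ultimately show ?thesis unfolding finite_rank_def by blast
qed

lemma compact_sum:
  assumes "T \<in> compact_operators E" "T' \<in> compact_operators F"
  shows "map_prod T T' \<in> compact_operators M"
  unfolding compact_operators_def
proof (rule op_closure_sum[OF assms[unfolded compact_operators_def]])
  show "finite_rank E \<subseteq> carrier E \<rightarrow> carrier E"
    by (auto simp: finite_rank_def intro!: E.finsum_closed)
  show "finite_rank F \<subseteq> carrier F \<rightarrow> carrier F"
    by (auto simp: finite_rank_def intro!: F.finsum_closed)
qed (rule finite_rank_sum)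

end

section \<open>Regular operators on a direct sum\<close>

context pre_hilbert
begin

lemma densely_defined_zero:
  assumes "densely_defined_operator E D"
  shows "app D \<zero> = \<zero>"
proof -
  have 0: "\<zero> \<in> Dom D" "app D \<zero> \<in> carrier E"
    using assms by (auto simp: densely_defined_operator_def)
  then have "app D (\<zero> \<oplus> \<zero>) = app D \<zero> \<oplus> app D \<zero>"
    using assms unfolding densely_defined_operator_def by blast
  then show ?thesis using 0 add.l_cancel_one[of "app D \<zero>" "app D \<zero>"] by simp
qed

lemma Dom_subset: "densely_defined_operator E D \<Longrightarrow> Dom D \<subseteq> carrier E"
  by (simp add: densely_defined_operator_def hdense_def)

lemma Dom_closed: "\<lbrakk>densely_defined_operator E D; x \<in> Dom D\<rbrakk> \<Longrightarrow> x \<in> carrier E"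
  using Dom_subset by blast

lemma app_closed: "\<lbrakk>densely_defined_operator E D; x \<in> Dom D\<rbrakk> \<Longrightarrow> app D x \<in> carrier E"
  unfolding densely_defined_operator_def by blast

lemma Dom_diff:
  assumes D: "densely_defined_operator E D" and xy: "x \<in> Dom D" "y \<in> Dom D"
  shows "x \<ominus> y \<in> Dom D"
proof -
  have y: "y \<in> carrier E" using Dom_closed[OF D] xy by auto
  \<comment> \<open>A domain is closed under sums and scalar multiples, and \<open>\<ominus> y\<close> is the multiple by \<open>-1\<close>.\<close>
  have "y \<oplus> (- 1) \<odot>\<^bsub>E\<^esub> y = (1 \<oplus>\<^bsub>complex_ring\<^esub> (- 1)) \<odot>\<^bsub>E\<^esub> y"
    using y smult_l_distr[of 1 "- 1" y] smult_one[of y] by (simp add: complex_ring_def)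
  also have "\<dots> = \<zero>"
    using smult_l_null[OF y] by (simp add: complex_ring_def)
  finally have "(- 1) \<odot>\<^bsub>E\<^esub> y = \<ominus> y"
    using y minus_equality[of "(- 1) \<odot>\<^bsub>E\<^esub> y" y] a_comm[of y "(- 1) \<odot>\<^bsub>E\<^esub> y"] by simp
  moreover have "x \<oplus> (- 1) \<odot>\<^bsub>E\<^esub> y \<in> Dom D"
    using D xy by (simp add: densely_defined_operator_def)
  ultimately show ?thesis by (simp add: a_minus_def)
qed

lemma even_odd_part_Dom:
  assumes D: "densely_defined_operator E D"
    and grade: "\<And>x. x \<in> Dom D \<Longrightarrow> hgrade E x \<in> Dom D"
    and T: "T ` Dom D \<subseteq> Dom D" and x: "x \<in> Dom D"
  shows "even_part E T x \<in> Dom D" "odd_part E T x \<in> Dom D"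
proof -
  have "T x \<in> Dom D" "hgrade E (T (hgrade E x)) \<in> Dom D"
    using T x grade by blast+
  then show "even_part E T x \<in> Dom D" "odd_part E T x \<in> Dom D"
    using D Dom_diff[OF D] by (simp_all add: even_part_def odd_part_def densely_defined_operator_def)
qed

end

lemma graded_hilbert_module_pre_hilbert: "graded_hilbert_module E \<Longrightarrow> pre_hilbert E"
  by (simp add: pre_hilbert_def graded_hilbert_module_def hilbert_module_def)

lemma hgrade_closed:
  "\<lbrakk>graded_hilbert_module E; x \<in> carrier E\<rbrakk> \<Longrightarrow> hgrade E x \<in> carrier E"
  by (simp add: graded_hilbert_module_def)

context pre_hilbert_pair
begin

lemma operator_sum_simps [simp]:
  "Dom (operator_sum D D') = Dom D \<times> Dom D'"
  "app (operator_sum D D') (x, y) = (app D x, app D' y)"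
  by (simp_all add: operator_sum_def)

lemma densely_defined_operator_sum:
  assumes "densely_defined_operator E D" "densely_defined_operator F D'"
  shows "densely_defined_operator M (operator_sum D D')"
proof -
  have "hdense M (Dom D \<times> Dom D')"
    using assms E.Dom_subset F.Dom_subset
    by (intro hdense_sum) (auto simp: densely_defined_operator_def)
  then show ?thesis
    using assms by (auto simp: densely_defined_operator_def)
qed

text \<open>From left to right, test against \<open>(x, 0)\<close> and \<open>(0, x')\<close>.\<close>

lemma adjoint_graph_sum:
  assumes D: "densely_defined_operator E D" "densely_defined_operator F D'"
  shows "((y, y'), (z, z')) \<in> adjoint_graph M (operator_sum D D') \<longleftrightarrow>
    (y, z) \<in> adjoint_graph E D \<and> (y', z') \<in> adjoint_graph F D'"
proof
  have 0: "\<zero>\<^bsub>E\<^esub> \<in> Dom D" "\<zero>\<^bsub>F\<^esub> \<in> Dom D'"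
    using D by (simp_all add: densely_defined_operator_def)
  assume g: "((y, y'), (z, z')) \<in> adjoint_graph M (operator_sum D D')"
  then have c: "y \<in> carrier E" "y' \<in> carrier F" "z \<in> carrier E" "z' \<in> carrier F"
    by (auto simp: adjoint_graph_def)
  have *: "hinner E (app D x) y + hinner F (app D' x') y' = hinner E x z + hinner F x' z'"
      if "x \<in> Dom D" "x' \<in> Dom D'" for x x'
    using that g by (auto simp: adjoint_graph_def)
  have "hinner E (app D x) y = hinner E x z" if "x \<in> Dom D" for x
    using *[OF that 0(2)] c F.densely_defined_zero[OF D(2)] by simp
  moreover have "hinner F (app D' x) y' = hinner F x z'" if "x \<in> Dom D'" for x
    using *[OF 0(1) that] c E.densely_defined_zero[OF D(1)] by simp
  ultimately show "(y, z) \<in> adjoint_graph E D \<and> (y', z') \<in> adjoint_graph F D'"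
    using c by (simp add: adjoint_graph_def)
qed (auto simp: adjoint_graph_def)

lemma self_adjoint_sum:
  assumes D: "densely_defined_operator E D" "densely_defined_operator F D'"
    and sa: "self_adjoint E D" "self_adjoint F D'"
  shows "self_adjoint M (operator_sum D D')"
proof -
  have E: "(y, z) \<in> adjoint_graph E D \<longleftrightarrow> y \<in> Dom D \<and> z = app D y" for y z
    using sa(1) by (auto simp: self_adjoint_def)
  have F: "(y, z) \<in> adjoint_graph F D' \<longleftrightarrow> y \<in> Dom D' \<and> z = app D' y" for y z
    using sa(2) by (auto simp: self_adjoint_def)
  have "((y, y'), (z, z')) \<in> adjoint_graph M (operator_sum D D') \<longleftrightarrow>
      (y, y') \<in> Dom (operator_sum D D') \<and> (z, z') = app (operator_sum D D') (y, y')" for y y' z z'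
    unfolding adjoint_graph_sum[OF D] E F by auto
  then show ?thesis unfolding self_adjoint_def by auto
qed

lemma closed_operator_sum:
  assumes D: "densely_defined_operator E D" "densely_defined_operator F D'"
    and cl: "closed_operator E D" "closed_operator F D'"
  shows "closed_operator M (operator_sum D D')"
  unfolding closed_operator_def
proof (intro allI ballI impI)
  fix Z z w assume zw: "z \<in> carrier M" "w \<in> carrier M"
    and Z: "(\<forall>n. Z n \<in> Dom (operator_sum D D')) \<and> hconverges M Z z \<and>
      hconverges M (\<lambda>n. app (operator_sum D D') (Z n)) w"
  define X Y where "X n = fst (Z n)" and "Y n = snd (Z n)" for n
  have ZXY: "Z = (\<lambda>n. (X n, Y n))" by (simp add: X_def Y_def)
  obtain x y x' y' where xy: "z = (x, y)" "w = (x', y')" "x \<in> carrier E" "y \<in> carrier F"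
    "x' \<in> carrier E" "y' \<in> carrier F"
    using zw by auto
  have dom: "X n \<in> Dom D" "Y n \<in> Dom D'" for n using Z by (simp_all add: ZXY)
  have c: "X n \<in> carrier E" "Y n \<in> carrier F" "app D (X n) \<in> carrier E" "app D' (Y n) \<in> carrier F" for n
    using dom D by (simp_all add: E.Dom_closed F.Dom_closed E.app_closed F.app_closed)
  have "hconverges M (\<lambda>n. (X n, Y n)) (x, y)" "hconverges M (\<lambda>n. (app D (X n), app D' (Y n))) (x', y')"
    using Z by (simp_all add: ZXY xy)
  then have "hconverges E X x" "hconverges F Y y" "hconverges E (\<lambda>n. app D (X n)) x'"
    "hconverges F (\<lambda>n. app D' (Y n)) y'"
    using c xy by (simp_all add: hconverges_sum_iff)
  then have "x \<in> Dom D \<and> app D x = x'" "y \<in> Dom D' \<and> app D' y = y'"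
    using cl dom xy unfolding closed_operator_def by metis+
  then show "z \<in> Dom (operator_sum D D') \<and> app (operator_sum D D') z = w"
    by (simp add: xy)
qed

lemma regular_sum:
  assumes "regular E D" "regular F D'"
  shows "regular M (operator_sum D D')"
proof -
  note E = assms(1)[unfolded regular_def] and F = assms(2)[unfolded regular_def]
  have D: "densely_defined_operator E D" "densely_defined_operator F D'" using E F by auto
  have "hdense M (Domain (adjoint_graph M (operator_sum D D')))"
  proof (rule hdense_sum)
    show "hdense E (Domain (adjoint_graph E D))" "hdense F (Domain (adjoint_graph F D'))"
      using E F by auto
    show "Domain (adjoint_graph E D) \<times> Domain (adjoint_graph F D') \<subseteq> Domain (adjoint_graph M (operator_sum D D'))"
      using adjoint_graph_sum[OF D] by (auto simp: Domain_iff)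
  qed (auto simp: adjoint_graph_def)
  moreover have "hdense M {x \<oplus>\<^bsub>M\<^esub> z | x z. x \<in> Dom (operator_sum D D') \<and>
      (app (operator_sum D D') x, z) \<in> adjoint_graph M (operator_sum D D')}" (is "hdense M ?S")
  proof (rule hdense_sum)
    show "hdense E {x \<oplus>\<^bsub>E\<^esub> z | x z. x \<in> Dom D \<and> (app D x, z) \<in> adjoint_graph E D}" (is "hdense E ?A")
      "hdense F {x \<oplus>\<^bsub>F\<^esub> z | x z. x \<in> Dom D' \<and> (app D' x, z) \<in> adjoint_graph F D'}" (is "hdense F ?B")
      using E F by auto
    show "?A \<times> ?B \<subseteq> ?S"
    proof clarify
      fix x y x' y' assume "x \<in> Dom D" "x' \<in> Dom D'" "(app D x, y) \<in> adjoint_graph E D"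
        "(app D' x', y') \<in> adjoint_graph F D'"
      then show "\<exists>v z. (x \<oplus>\<^bsub>E\<^esub> y, x' \<oplus>\<^bsub>F\<^esub> y') = v \<oplus>\<^bsub>M\<^esub> z \<and> v \<in> Dom (operator_sum D D') \<and>
          (app (operator_sum D D') v, z) \<in> adjoint_graph M (operator_sum D D')"
        using adjoint_graph_sum[OF D]
        by (intro exI[of _ "(x, x')"] exI[of _ "(y, y')"]) simp
    qed
    show "?S \<subseteq> carrier M"
      using D by (auto simp: adjoint_graph_def E.Dom_closed F.Dom_closed)
  qed
  ultimately show ?thesis
    unfolding regular_def using densely_defined_operator_sum closed_operator_sum E F by blast
qed

lemma is_inv_sqrt_sum:
  assumes "is_inv_sqrt E D R" "is_inv_sqrt F D' R'"
  shows "is_inv_sqrt M (operator_sum D D') (map_prod R R')"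
  unfolding is_inv_sqrt_def
proof (intro conjI ballI impI)
  note R = assms[unfolded is_inv_sqrt_def]
  show "map_prod R R' \<in> adjointable M" using R by (intro adjointable_sum) auto
  fix z
  {
    assume "z \<in> carrier M"
    then obtain x y where z: "z = (x, y)" "x \<in> carrier E" "y \<in> carrier F" by auto
    show "positive (hinner M (map_prod R R' z) z)"
      using R z by (simp add: positive_add)
    show "map_prod R R' (map_prod R R' z) \<in> Dom (operator_sum D D')"
      "app (operator_sum D D') (map_prod R R' (map_prod R R' z)) \<in> Dom (operator_sum D D')"
      "map_prod R R' (map_prod R R' z) \<oplus>\<^bsub>M\<^esub>
        app (operator_sum D D') (app (operator_sum D D') (map_prod R R' (map_prod R R' z))) = z"
      using R z by simp_all
  next
    assume "z \<in> Dom (operator_sum D D')" "app (operator_sum D D') z \<in> Dom (operator_sum D D')"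
    then obtain x y where z: "z = (x, y)" "x \<in> Dom D" "y \<in> Dom D'" "app D x \<in> Dom D" "app D' y \<in> Dom D'"
      by auto
    show "map_prod R R' (map_prod R R' (z \<oplus>\<^bsub>M\<^esub> app (operator_sum D D') (app (operator_sum D D') z))) = z"
      using R z by simp
  }
qed

lemma even_part_sum:
  "even_part M (map_prod T T') (x, y) = (even_part E T x, even_part F T' y)"
  by (simp add: even_part_def)

end

lemma even_part_closed:
  assumes gr: "graded_hilbert_module E" and T: "T \<in> carrier E \<rightarrow> carrier E" and x: "x \<in> carrier E"
  shows "even_part E T x \<in> carrier E"
proof -
  interpret pre_hilbert E by (rule graded_hilbert_module_pre_hilbert[OF gr])
  have "T x \<in> carrier E" "hgrade E (T (hgrade E x)) \<in> carrier E"
    using x T by (simp_all add: hgrade_closed[OF gr] Pi_mem[OF T])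
  then show ?thesis by (simp add: even_part_def)
qed

section \<open>Lipschitz operators and the direct sum of cycles\<close>

locale graded_hilbert_pair = pre_hilbert_pair E F
  for E :: "('b::graded_cstar_algebra, 'e) hilbert_module" and F :: "('b, 'f) hilbert_module" +
  assumes gr: "graded_hilbert_module E" "graded_hilbert_module F"
begin

lemma graded_hilbert_module_sum:
  shows "graded_hilbert_module M"
  using gr hilbert_module_sum by (auto simp: graded_hilbert_module_def grading_add)

lemma graded_representation_sum:
  assumes "graded_representation E \<pi>" "graded_representation F \<rho>"
  shows "graded_representation M (rep_sum \<pi> \<rho>)"
  unfolding graded_representation_def rep_sum_def
proof (intro conjI allI ballI)
  have ad: "\<pi> a \<in> adjointable E" "\<rho> a \<in> adjointable F" for a
    using assms by (simp_all add: graded_representation_def)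
  fix a b c z
  show "map_prod (\<pi> a) (\<rho> a) \<in> adjointable M" by (intro adjointable_sum ad)
  assume z: "z \<in> carrier M"
  then obtain x y where xy: "z = (x, y)" "x \<in> carrier E" "y \<in> carrier F" by auto
  show "map_prod (\<pi> (star a)) (\<rho> (star a)) z = adj M (map_prod (\<pi> a) (\<rho> a)) z"
    using assms xy unfolding adj_sum[OF ad z] graded_representation_def by simp
  show "map_prod (\<pi> (a + b)) (\<rho> (a + b)) z = map_prod (\<pi> a) (\<rho> a) z \<oplus>\<^bsub>M\<^esub> map_prod (\<pi> b) (\<rho> b) z"
    "map_prod (\<pi> (c *\<^sub>C a)) (\<rho> (c *\<^sub>C a)) z = c \<odot>\<^bsub>M\<^esub> map_prod (\<pi> a) (\<rho> a) z"
    "map_prod (\<pi> (a * b)) (\<rho> (a * b)) z = map_prod (\<pi> a) (\<rho> a) (map_prod (\<pi> b) (\<rho> b) z)"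
    "map_prod (\<pi> (grading a)) (\<rho> (grading a)) z = hgrade M (map_prod (\<pi> a) (\<rho> a) (hgrade M z))"
    using assms xy unfolding graded_representation_def by simp_all
qed

lemma odd_operator_sum:
  assumes D: "densely_defined_operator E D" "densely_defined_operator F D'"
    and odd: "odd_operator E D" "odd_operator F D'"
  shows "odd_operator M (operator_sum D D')"
  unfolding odd_operator_def
proof
  fix z assume "z \<in> Dom (operator_sum D D')"
  then obtain x y where z: "z = (x, y)" "x \<in> Dom D" "y \<in> Dom D'" by auto
  then have "hgrade E (app D x) \<in> carrier E" "hgrade F (app D' y) \<in> carrier F"
    using D gr by (simp_all add: hgrade_closed E.app_closed F.app_closed)
  then show "hgrade M z \<in> Dom (operator_sum D D') \<and>
      app (operator_sum D D') (hgrade M z) = \<ominus>\<^bsub>M\<^esub> hgrade M (app (operator_sum D D') z)"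
    using odd z by (simp add: odd_operator_def)
qed

lemma odd_part_sum:
  assumes "T \<in> carrier E \<rightarrow> carrier E" "T' \<in> carrier F \<rightarrow> carrier F" "x \<in> carrier E" "y \<in> carrier F"
  shows "odd_part M (map_prod T T') (x, y) = (odd_part E T x, odd_part F T' y)"
proof -
  have "hgrade E (T (hgrade E x)) \<in> carrier E" "hgrade F (T' (hgrade F y)) \<in> carrier F"
    using assms by (simp_all add: hgrade_closed[OF gr(1)] hgrade_closed[OF gr(2)] Pi_mem[OF assms(1)] Pi_mem[OF assms(2)])
  then show ?thesis by (simp add: odd_part_def)
qed


lemma graded_commutator_sum:
  assumes D: "densely_defined_operator E D" "densely_defined_operator F D'"
    and T: "T \<in> carrier E \<rightarrow> carrier E" "T' \<in> carrier F \<rightarrow> carrier F"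
    and xy: "x \<in> Dom D" "y \<in> Dom D'"
  shows "graded_commutator M (operator_sum D D') (map_prod T T') (x, y)
    = (graded_commutator E D T x, graded_commutator F D' T' y)"
proof -
  have c: "x \<in> carrier E" "y \<in> carrier F" "app D x \<in> carrier E" "app D' y \<in> carrier F"
    using xy D by (simp_all add: E.Dom_closed F.Dom_closed E.app_closed F.app_closed)
  have "even_part E T (app D x) \<in> carrier E" "even_part F T' (app D' y) \<in> carrier F"
    using c gr T by (simp_all add: even_part_closed)
  then show ?thesis
    using c gr T by (simp add: graded_commutator_def even_part_sum odd_part_sum)
qed

lemma Lip_sum:
  assumes D: "densely_defined_operator E D" "densely_defined_operator F D'"
    and T: "T \<in> Lip E D" "T' \<in> Lip F D'"
  shows "map_prod T T' \<in> Lip M (operator_sum D D')"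
proof -
  obtain C where C: "C \<in> adjointable E" "\<And>x. x \<in> Dom D \<Longrightarrow> C x = graded_commutator E D T x"
    using T(1) by (auto simp: Lip_def)
  obtain C' where C': "C' \<in> adjointable F" "\<And>x. x \<in> Dom D' \<Longrightarrow> C' x = graded_commutator F D' T' x"
    using T(2) by (auto simp: Lip_def)
  have T': "T \<in> adjointable E" "T' \<in> adjointable F" "T ` Dom D \<subseteq> Dom D" "T' ` Dom D' \<subseteq> Dom D'"
    using T by (simp_all add: Lip_def)
  then have "T \<in> carrier E \<rightarrow> carrier E" "T' \<in> carrier F \<rightarrow> carrier F"
    by (simp_all add: adjointable_def)
  note * = graded_commutator_sum[OF D this]
  have "\<forall>z\<in>Dom (operator_sum D D'). map_prod C C' z = graded_commutator M (operator_sum D D') (map_prod T T') z"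
    using C(2) C'(2) by (auto simp: *)
  moreover have "map_prod T T' ` Dom (operator_sum D D') \<subseteq> Dom (operator_sum D D')"
    using T'(3,4) by auto
  ultimately show ?thesis
    unfolding Lip_def using T'(1,2) C(1) C'(1) adjointable_sum by blast
qed

lemma Lip0_sum:
  assumes D: "densely_defined_operator E D" "densely_defined_operator F D'"
    and T: "T \<in> Lip0 E D" "T' \<in> Lip0 F D'"
  shows "map_prod T T' \<in> Lip0 M (operator_sum D D')"
proof -
  obtain R where R: "is_inv_sqrt E D R" "T \<circ> R \<in> compact_operators E" "adj E T \<circ> R \<in> compact_operators E"
    using T(1) by (auto simp: Lip0_def)
  obtain R' where R': "is_inv_sqrt F D' R'" "T' \<circ> R' \<in> compact_operators F" "adj F T' \<circ> R' \<in> compact_operators F"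
    using T(2) by (auto simp: Lip0_def)
  have L: "T \<in> Lip E D" "T' \<in> Lip F D'" using T by (simp_all add: Lip0_def)
  then have ad: "T \<in> adjointable E" "T' \<in> adjointable F" by (simp_all add: Lip_def)
  have RR: "map_prod R R' z \<in> carrier M" if "z \<in> carrier M" for z
    using R(1) R'(1) that by (auto simp: is_inv_sqrt_def adjointable_def)
  have 1: "map_prod T T' \<circ> map_prod R R' \<in> compact_operators M"
    using compact_sum[OF R(2) R'(2)] by (simp add: map_prod_compose)
  have "map_prod (adj E T) (adj F T') \<circ> map_prod R R' \<in> compact_operators M"
    using compact_sum[OF R(3) R'(3)] by (simp add: map_prod_compose)
  then have 2: "adj M (map_prod T T') \<circ> map_prod R R' \<in> compact_operators M"
    unfolding compact_operators_def
    by (rule op_closure_cong) (simp only: comp_apply adj_sum[OF ad RR])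
  show ?thesis
    unfolding Lip0_def using Lip_sum[OF D L] is_inv_sqrt_sum[OF R(1) R'(1)] 1 2 by blast
qed

end

theorem unbounded_cycle_sum:
  assumes "unbounded_cycle (\<pi>, E, D)" "unbounded_cycle (\<rho>, F, D')"
  shows "unbounded_cycle (rep_sum \<pi> \<rho>, module_sum E F, operator_sum D D')"
proof -
  have gr: "graded_hilbert_module E" "graded_hilbert_module F"
    using assms by simp_all
  interpret graded_hilbert_pair E F
    using gr gr[THEN graded_hilbert_module_pre_hilbert]
    by (simp add: graded_hilbert_pair_def graded_hilbert_pair_axioms_def pre_hilbert_pair_def)
  have D: "densely_defined_operator E D" "densely_defined_operator F D'"
    using assms by (simp_all add: regular_def)
  have "rep_sum \<pi> \<rho> a \<in> op_closure M (Lip0 M (operator_sum D D'))" for a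
    unfolding rep_sum_def
  proof (rule op_closure_sum)
    show "\<pi> a \<in> op_closure E (Lip0 E D)" "\<rho> a \<in> op_closure F (Lip0 F D')"
      using assms by auto
    show "Lip0 E D \<subseteq> carrier E \<rightarrow> carrier E" "Lip0 F D' \<subseteq> carrier F \<rightarrow> carrier F"
      by (auto simp: Lip0_def Lip_def adjointable_def)
    show "map_prod S S' \<in> Lip0 M (operator_sum D D')" if "S \<in> Lip0 E D" "S' \<in> Lip0 F D'" for S S'
      using assms that by (intro Lip0_sum[OF D]) simp_all
  qed
  then show ?thesis
    using assms D graded_hilbert_module_sum countably_generated_sum graded_representation_sum
      regular_sum self_adjoint_sum odd_operator_sum by auto
qed

section \<open>Transport of a cycle along an injection\<close>

text \<open>The structure on the image of the carrier for which an injection \<open>\<phi>\<close> becomes unitary.\<close>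

definition module_image :: "('e \<Rightarrow> 'f) \<Rightarrow> ('b::cstar_algebra, 'e) hilbert_module \<Rightarrow> ('b, 'f) hilbert_module"
  where "module_image \<phi> E = (let \<psi> = inv_into (carrier E) \<phi> in
    \<lparr>carrier = \<phi> ` carrier E, mult = undefined, one = undefined, zero = \<phi> \<zero>\<^bsub>E\<^esub>,
     add = (\<lambda>u v. \<phi> (\<psi> u \<oplus>\<^bsub>E\<^esub> \<psi> v)),
     smult = (\<lambda>c u. \<phi> (c \<odot>\<^bsub>E\<^esub> \<psi> u)),
     act = (\<lambda>u b. \<phi> (act E (\<psi> u) b)),
     hinner = (\<lambda>u v. hinner E (\<psi> u) (\<psi> v)),
     hgrade = (\<lambda>u. \<phi> (hgrade E (\<psi> u)))\<rparr>)"

definition conjugate :: "('e \<Rightarrow> 'f) \<Rightarrow> ('b::cstar_algebra, 'e) hilbert_module \<Rightarrow> ('e \<Rightarrow> 'e) \<Rightarrow> 'f \<Rightarrow> 'f"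
  where "conjugate \<phi> E T u = \<phi> (T (inv_into (carrier E) \<phi> u))"

definition operator_image :: "('e \<Rightarrow> 'f) \<Rightarrow> ('b::cstar_algebra, 'e) hilbert_module \<Rightarrow>
    'e unbounded_operator \<Rightarrow> 'f unbounded_operator"
  where "operator_image \<phi> E D = \<lparr>Dom = \<phi> ` Dom D, app = conjugate \<phi> E (app D)\<rparr>"

locale pre_hilbert_image = pre_hilbert E
  for E :: "('b::cstar_algebra, 'e) hilbert_module" (structure) +
  fixes \<phi> :: "'e \<Rightarrow> 'f"
  assumes inj: "inj_on \<phi> (carrier E)"
begin

abbreviation F :: "('b, 'f) hilbert_module" where "F \<equiv> module_image \<phi> E"
abbreviation transport :: "('e \<Rightarrow> 'e) \<Rightarrow> 'f \<Rightarrow> 'f" where "transport \<equiv> conjugate \<phi> E"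

lemma image_simps [simp]:
  "carrier F = \<phi> ` carrier E" "\<zero>\<^bsub>F\<^esub> = \<phi> \<zero>"
  "\<lbrakk>x \<in> carrier E; y \<in> carrier E\<rbrakk> \<Longrightarrow> \<phi> x \<oplus>\<^bsub>F\<^esub> \<phi> y = \<phi> (x \<oplus> y)"
  "x \<in> carrier E \<Longrightarrow> c \<odot>\<^bsub>F\<^esub> \<phi> x = \<phi> (c \<odot> x)"
  "x \<in> carrier E \<Longrightarrow> act F (\<phi> x) b = \<phi> (act E x b)"
  "\<lbrakk>x \<in> carrier E; y \<in> carrier E\<rbrakk> \<Longrightarrow> hinner F (\<phi> x) (\<phi> y) = hinner E x y"
  "x \<in> carrier E \<Longrightarrow> hgrade F (\<phi> x) = \<phi> (hgrade E x)"
  "x \<in> carrier E \<Longrightarrow> transport T (\<phi> x) = \<phi> (T x)"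
  "\<lbrakk>x \<in> carrier E; y \<in> carrier E\<rbrakk> \<Longrightarrow> \<phi> x = \<phi> y \<longleftrightarrow> x = y"
  using inj by (simp_all add: module_image_def conjugate_def Let_def inj_on_eq_iff)

lemma image_mem_iff: "\<lbrakk>x \<in> carrier E; S \<subseteq> carrier E\<rbrakk> \<Longrightarrow> \<phi> x \<in> \<phi> ` S \<longleftrightarrow> x \<in> S"
  using inj by (rule inj_on_image_mem_iff)

lemma abelian_group_image: "abelian_group F"
proof (rule abelian_groupI)
  fix z assume "z \<in> carrier F"
  then obtain x where "z = \<phi> x" "x \<in> carrier E" by auto
  then show "\<exists>w\<in>carrier F. w \<oplus>\<^bsub>F\<^esub> z = \<zero>\<^bsub>F\<^esub>"
    by (intro bexI[of _ "\<phi> (\<ominus> x)"]) (simp_all add: l_neg)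
qed (auto simp: a_assoc intro: a_comm)

lemma module_image_module: "module complex_ring F"
proof (rule moduleI)
  show "cring complex_ring" by (rule R.is_cring)
qed (auto simp: abelian_group_image smult_l_distr smult_r_distr smult_assoc1)

lemma pre_hilbert_module_image: "pre_hilbert_module F"
  using pre_hilbert by (simp add: pre_hilbert_module_def module_image_module)

sublocale F: pre_hilbert F
  by unfold_locales (rule pre_hilbert_module_image)

lemma minus_image [simp]: "x \<in> carrier E \<Longrightarrow> \<ominus>\<^bsub>F\<^esub> \<phi> x = \<phi> (\<ominus> x)"
  by (rule F.minus_equality) (simp_all add: l_neg)

lemma diff_image [simp]: "\<lbrakk>x \<in> carrier E; y \<in> carrier E\<rbrakk> \<Longrightarrow> \<phi> x \<ominus>\<^bsub>F\<^esub> \<phi> y = \<phi> (x \<ominus> y)"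
  by (simp add: a_minus_def)

lemma hnorm_image [simp]: "x \<in> carrier E \<Longrightarrow> hnorm F (\<phi> x) = hnorm E x"
  by (simp add: hnorm_def)

lemma finsum_image:
  "\<lbrakk>\<And>i. i \<in> I \<Longrightarrow> f i \<in> carrier E; finite I\<rbrakk> \<Longrightarrow> (\<Oplus>\<^bsub>F\<^esub>i\<in>I. \<phi> (f i)) = \<phi> (\<Oplus>i\<in>I. f i)"
  by (rule additive_finsum[of E F \<phi>, symmetric])
    (auto simp: abelian_group_image abelian_group_axioms)

lemma hconverges_image_iff:
  assumes "\<And>n. X n \<in> carrier E" "x \<in> carrier E"
  shows "hconverges F (\<lambda>n. \<phi> (X n)) (\<phi> x) \<longleftrightarrow> hconverges E X x"
  using assms by (simp add: hconverges_def)

lemma sequence_preimage: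
  assumes "\<And>n. X n \<in> \<phi> ` S"
  obtains Y where "\<And>n. Y n \<in> S" "X = (\<lambda>n. \<phi> (Y n))"
proof -
  have "\<forall>n. \<exists>y. y \<in> S \<and> X n = \<phi> y" using assms by blast
  then obtain Y where "\<forall>n. Y n \<in> S \<and> X n = \<phi> (Y n)" by metis
  then show thesis by (intro that[of Y]) auto
qed

lemma hilbert_module_image:
  assumes "hilbert_module E"
  shows "hilbert_module F"
  unfolding hilbert_module_def
proof (intro conjI allI impI pre_hilbert_module_image)
  fix X assume X: "(\<forall>n. X n \<in> carrier F) \<and> hCauchy F X"
  then have "X n \<in> \<phi> ` carrier E" for n by simp
  from sequence_preimage[of X, OF this]
  obtain Y where Y: "\<And>n. Y n \<in> carrier E" "X = (\<lambda>n. \<phi> (Y n))" by blast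
  have "hCauchy E Y" using X Y by (simp add: hCauchy_def)
  then obtain y where "y \<in> carrier E" "hconverges E Y y"
    using assms Y unfolding hilbert_module_def by blast
  then show "\<exists>x\<in>carrier F. hconverges F X x"
    using Y by (intro bexI[of _ "\<phi> y"]) (simp_all add: hconverges_image_iff)
qed

lemma hdense_image:
  assumes S: "hdense E S" "\<phi> ` S \<subseteq> S'" "S' \<subseteq> carrier F"
  shows "hdense F S'"
  unfolding hdense_def
proof (intro conjI ballI allI impI S(3))
  fix u and \<epsilon> :: real assume "u \<in> carrier F" and \<epsilon>: "0 < \<epsilon>"
  then obtain x where x: "u = \<phi> x" "x \<in> carrier E" by auto
  then obtain s where s: "s \<in> S" "hnorm E (x \<ominus> s) < \<epsilon>"
    using S(1) \<epsilon> unfolding hdense_def by blast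
  moreover have "s \<in> carrier E" using S(1) s(1) by (auto simp: hdense_def)
  ultimately show "\<exists>s\<in>S'. hnorm F (u \<ominus>\<^bsub>F\<^esub> s) < \<epsilon>"
    using S(2) x by (intro bexI[of _ "\<phi> s"]) auto
qed

lemma countably_generated_image:
  assumes "countably_generated E"
  shows "countably_generated F"
proof -
  obtain G where G: "G \<subseteq> carrier E" "countable G"
    "hdense E {(\<Oplus>i\<in>{..<n}. act E (g i) (b i)) | (n::nat) g b. \<forall>i<n. g i \<in> G}"
    using assms unfolding countably_generated_def by blast
  have "hdense F {(\<Oplus>\<^bsub>F\<^esub>i\<in>{..<n}. act F (g i) (b i)) | (n::nat) g b. \<forall>i<n. g i \<in> \<phi> ` G}"
  proof (rule hdense_image[OF G(3)]; clarify)
    fix n :: nat and g b assume g: "\<forall>i<n. g i \<in> G"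
    then have gc: "g i \<in> carrier E" if "i < n" for i using that G(1) by blast
    have "\<phi> (\<Oplus>i\<in>{..<n}. act E (g i) (b i)) = (\<Oplus>\<^bsub>F\<^esub>i\<in>{..<n}. \<phi> (act E (g i) (b i)))"
      using gc by (intro finsum_image[symmetric]) auto
    also have "\<dots> = (\<Oplus>\<^bsub>F\<^esub>i\<in>{..<n}. act F (\<phi> (g i)) (b i))"
      using gc by (intro F.finsum_cong) (auto simp: simp_implies_def)
    finally show "\<exists>n' g' b'. \<phi> (\<Oplus>i\<in>{..<n}. act E (g i) (b i)) = (\<Oplus>\<^bsub>F\<^esub>i\<in>{..<n'}. act F (g' i) (b' i))
        \<and> (\<forall>i<(n'::nat). g' i \<in> \<phi> ` G)"
      using g by (intro exI[of _ n] exI[of _ "\<lambda>i. \<phi> (g i)"] exI[of _ b]) simp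
  next
    fix n :: nat and g b assume g: "\<forall>i<n. g i \<in> \<phi> ` G"
    have "(\<lambda>i. act F (g i) (b i)) \<in> {..<n} \<rightarrow> carrier F"
      using g G(1) by (intro Pi_I F.act_closed) auto
    then show "(\<Oplus>\<^bsub>F\<^esub>i\<in>{..<n}. act F (g i) (b i)) \<in> carrier F" by (simp only: F.finsum_closed)
  qed
  moreover have "\<phi> ` G \<subseteq> carrier F" "countable (\<phi> ` G)" using G by auto
  ultimately show ?thesis unfolding countably_generated_def by blast
qed

lemma is_adjoint_image:
  assumes "T \<in> carrier E \<rightarrow> carrier E" "is_adjoint E T S"
  shows "is_adjoint F (transport T) (transport S)"
proof -
  have "T x \<in> carrier E" "S x \<in> carrier E" if "x \<in> carrier E" for x
    using assms that by (auto simp: is_adjoint_def)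
  then show ?thesis using assms(2) by (auto simp: is_adjoint_def)
qed

lemma transport_Pi: "T \<in> carrier E \<rightarrow> carrier E \<Longrightarrow> transport T \<in> carrier F \<rightarrow> carrier F"
  by auto

lemma adjointable_image:
  assumes "T \<in> adjointable E"
  shows "transport T \<in> adjointable F"
proof -
  have T: "T \<in> carrier E \<rightarrow> carrier E" using assms by (simp add: adjointable_def)
  show ?thesis
    using is_adjoint_image[OF T is_adjoint_adj[OF assms]] transport_Pi[OF T] unfolding adjointable_def by blast
qed

lemma adj_image:
  assumes "T \<in> adjointable E" "u \<in> carrier F"
  shows "adj F (transport T) u = transport (adj E T) u"
proof (rule F.adj_eq[OF adjointable_image[OF assms(1)] _ assms(2)])
  show "is_adjoint F (transport T) (transport (adj E T))"
    using assms(1) by (intro is_adjoint_image is_adjoint_adj) (simp_all add: adjointable_def)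
qed

lemma op_closure_image:
  assumes T: "T \<in> op_closure E W" and W: "W \<subseteq> carrier E \<rightarrow> carrier E"
    and transport: "\<And>S. S \<in> W \<Longrightarrow> transport S \<in> W'"
  shows "transport T \<in> op_closure F W'"
  unfolding op_closure_def
proof (intro CollectI conjI allI impI)
  have ad: "T \<in> adjointable E" using T by (simp add: op_closure_def)
  then show "transport T \<in> adjointable F" by (rule adjointable_image)
  fix \<epsilon> :: real assume "\<epsilon> > 0"
  then obtain S where S: "S \<in> W" "\<And>x. x \<in> carrier E \<Longrightarrow> hnorm E (T x \<ominus> S x) \<le> \<epsilon> * hnorm E x"
    using T unfolding op_closure_def by blast
  have "T \<in> carrier E \<rightarrow> carrier E" "S \<in> carrier E \<rightarrow> carrier E"
    using W S(1) ad by (auto simp: adjointable_def)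
  then have "\<forall>u\<in>carrier F. hnorm F (transport T u \<ominus>\<^bsub>F\<^esub> transport S u) \<le> \<epsilon> * hnorm F u"
    using S(2) by (simp add: Pi_iff)
  then show "\<exists>S\<in>W'. \<forall>u\<in>carrier F. hnorm F (transport T u \<ominus>\<^bsub>F\<^esub> S u) \<le> \<epsilon> * hnorm F u"
    using transport[OF S(1)] by blast
qed

lemma finite_rank_image:
  assumes "T \<in> finite_rank E"
  shows "transport T \<in> finite_rank F"
proof -
  obtain n f g where T: "\<And>i. f i \<in> carrier E" "\<And>i. g i \<in> carrier E"
    "\<And>x. x \<in> carrier E \<Longrightarrow> T x = (\<Oplus>i\<in>{..<n::nat}. act E (f i) (hinner E (g i) x))"
    using assms unfolding finite_rank_def by blast
  have "transport T u = (\<Oplus>\<^bsub>F\<^esub>i\<in>{..<n}. act F (\<phi> (f i)) (hinner F (\<phi> (g i)) u))" if u_in: "u \<in> carrier F" for u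
  proof -
    obtain x where u: "u = \<phi> x" "x \<in> carrier E" using u_in by auto
    have "transport T u = (\<Oplus>\<^bsub>F\<^esub>i\<in>{..<n}. \<phi> (act E (f i) (hinner E (g i) x)))"
      using T u by (simp add: finsum_image)
    then show ?thesis using T u by simp
  qed
  then show ?thesis
    unfolding finite_rank_def using T
    by (intro CollectI exI[of _ n] exI[of _ "\<lambda>i. \<phi> (f i)"] exI[of _ "\<lambda>i. \<phi> (g i)"]) simp
qed

lemma compact_image: "T \<in> compact_operators E \<Longrightarrow> transport T \<in> compact_operators F"
  unfolding compact_operators_def
  by (rule op_closure_image[OF _ _ finite_rank_image])
    (auto simp: finite_rank_def intro!: finsum_closed)

lemma operator_image_simps [simp]:
  "Dom (operator_image \<phi> E D) = \<phi> ` Dom D" "app (operator_image \<phi> E D) = transport (app D)"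
  by (simp_all add: operator_image_def)

end

locale graded_hilbert_image = pre_hilbert_image E \<phi>
  for E :: "('b::graded_cstar_algebra, 'e) hilbert_module" and \<phi> :: "'e \<Rightarrow> 'f" +
  assumes gr: "graded_hilbert_module E"
begin

lemma hgrade_in [simp]: "x \<in> carrier E \<Longrightarrow> hgrade E x \<in> carrier E"
  by (rule hgrade_closed[OF gr])

lemma graded_hilbert_module_image: "graded_hilbert_module F"
  using gr hilbert_module_image by (simp add: graded_hilbert_module_def)

lemma graded_representation_image:
  assumes "graded_representation E \<pi>"
  shows "graded_representation F (\<lambda>a. transport (\<pi> a))"
proof -
  have ad: "\<pi> a \<in> adjointable E" for a
    using assms by (simp add: graded_representation_def)
  then have cl: "\<pi> a x \<in> carrier E" if "x \<in> carrier E" for a x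
    using that by (auto simp: adjointable_def)
  have "adj F (transport (\<pi> a)) (\<phi> x) = \<phi> (adj E (\<pi> a) x)" if "x \<in> carrier E" for a x
    using adj_image[OF ad, of "\<phi> x"] that by simp
  then show ?thesis
    using assms cl adjointable_image[OF ad] by (simp add: graded_representation_def)
qed

context
  fixes D :: "'e unbounded_operator"
  assumes D: "densely_defined_operator E D"
begin

abbreviation D' :: "'f unbounded_operator" where "D' \<equiv> operator_image \<phi> E D"

lemmas Dom_mem [simp] = Dom_closed[OF D] app_closed[OF D]

lemma Dom_mem_iff [simp]: "x \<in> carrier E \<Longrightarrow> \<phi> x \<in> \<phi> ` Dom D \<longleftrightarrow> x \<in> Dom D"
  by (rule image_mem_iff) (simp_all add: Dom_subset[OF D])

lemma densely_defined_operator_image: "densely_defined_operator F D'"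
proof -
  have "hdense F (\<phi> ` Dom D)"
    using D Dom_subset[OF D] by (intro hdense_image) (auto simp: densely_defined_operator_def)
  then show ?thesis
    using D by (auto simp: densely_defined_operator_def)
qed

lemma adjoint_graph_image_iff:
  assumes "x \<in> carrier E" "y \<in> carrier E"
  shows "(\<phi> x, \<phi> y) \<in> adjoint_graph F D' \<longleftrightarrow> (x, y) \<in> adjoint_graph E D"
  using assms by (simp add: adjoint_graph_def)

lemma self_adjoint_image:
  assumes "self_adjoint E D"
  shows "self_adjoint F D'"
proof -
  have E: "(x, y) \<in> adjoint_graph E D \<longleftrightarrow> x \<in> Dom D \<and> y = app D x" for x y
    using assms by (auto simp: self_adjoint_def)
  have "(u, v) \<in> adjoint_graph F D' \<longleftrightarrow> u \<in> Dom D' \<and> v = app D' u" for u v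
  proof (cases "u \<in> carrier F \<and> v \<in> carrier F")
    case True
    then obtain x y where xy: "u = \<phi> x" "v = \<phi> y" "x \<in> carrier E" "y \<in> carrier E" by auto
    then show ?thesis by (auto simp: adjoint_graph_image_iff E)
  next
    case False
    then have "(u, v) \<notin> adjoint_graph F D'" by (auto simp: adjoint_graph_def)
    moreover have "\<not> (u \<in> Dom D' \<and> v = app D' u)" using False by auto
    ultimately show ?thesis by blast
  qed
  then show ?thesis unfolding self_adjoint_def by auto
qed

lemma closed_operator_image:
  assumes "closed_operator E D"
  shows "closed_operator F D'"
  unfolding closed_operator_def
proof (intro allI ballI impI)
  fix X u v assume "u \<in> carrier F" "v \<in> carrier F"
    and X: "(\<forall>n. X n \<in> Dom D') \<and> hconverges F X u \<and> hconverges F (\<lambda>n. app D' (X n)) v"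
  then obtain x y where xy: "u = \<phi> x" "v = \<phi> y" "x \<in> carrier E" "y \<in> carrier E" by auto
  have "X n \<in> \<phi> ` Dom D" for n using X by simp
  from sequence_preimage[of X, OF this]
  obtain Y where Y: "\<And>n. Y n \<in> Dom D" "X = (\<lambda>n. \<phi> (Y n))" by blast
  have "hconverges E Y x" "hconverges E (\<lambda>n. app D (Y n)) y"
    using X Y xy by (simp_all add: hconverges_image_iff)
  then have "x \<in> Dom D \<and> app D x = y"
    using assms Y(1) xy unfolding closed_operator_def by blast
  then show "u \<in> Dom D' \<and> app D' u = v" using xy by simp
qed

lemma regular_image:
  assumes "regular E D"
  shows "regular F D'"
proof -
  note E = assms[unfolded regular_def]
  have "hdense F (Domain (adjoint_graph F D'))"
  proof (rule hdense_image)
    show "hdense E (Domain (adjoint_graph E D))" using E by blast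
    show "\<phi> ` Domain (adjoint_graph E D) \<subseteq> Domain (adjoint_graph F D')"
    proof clarify
      fix x y assume xy: "(x, y) \<in> adjoint_graph E D"
      then have "x \<in> carrier E" "y \<in> carrier E" by (simp_all add: adjoint_graph_def)
      then show "\<phi> x \<in> Domain (adjoint_graph F D')"
        using xy adjoint_graph_image_iff by (intro DomainI[of _ "\<phi> y"]) simp
    qed
  qed (auto simp: adjoint_graph_def)
  moreover have "hdense F {u \<oplus>\<^bsub>F\<^esub> v | u v. u \<in> Dom D' \<and> (app D' u, v) \<in> adjoint_graph F D'}"
  proof (rule hdense_image)
    show "hdense E {x \<oplus>\<^bsub>E\<^esub> z | x z. x \<in> Dom D \<and> (app D x, z) \<in> adjoint_graph E D}" using E by blast
    show "\<phi> ` {x \<oplus>\<^bsub>E\<^esub> z | x z. x \<in> Dom D \<and> (app D x, z) \<in> adjoint_graph E D} \<subseteq>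
      {u \<oplus>\<^bsub>F\<^esub> v | u v. u \<in> Dom D' \<and> (app D' u, v) \<in> adjoint_graph F D'}"
    proof clarify
      fix x z assume x: "x \<in> Dom D" "(app D x, z) \<in> adjoint_graph E D"
      then have "z \<in> carrier E" by (simp add: adjoint_graph_def)
      then show "\<exists>u v. \<phi> (x \<oplus>\<^bsub>E\<^esub> z) = u \<oplus>\<^bsub>F\<^esub> v \<and> u \<in> Dom D' \<and> (app D' u, v) \<in> adjoint_graph F D'"
        using x adjoint_graph_image_iff[of "app D x" z]
        by (intro exI[of _ "\<phi> x"] exI[of _ "\<phi> z"]) simp
    qed
    show "{u \<oplus>\<^bsub>F\<^esub> v | u v. u \<in> Dom D' \<and> (app D' u, v) \<in> adjoint_graph F D'} \<subseteq> carrier F"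
      by (auto simp: adjoint_graph_def)
  qed
  ultimately show ?thesis
    unfolding regular_def using densely_defined_operator_image closed_operator_image E by blast
qed

lemma odd_operator_image:
  assumes "odd_operator E D"
  shows "odd_operator F D'"
  using assms by (simp add: odd_operator_def)

lemma is_inv_sqrt_image:
  assumes "is_inv_sqrt E D R"
  shows "is_inv_sqrt F D' (transport R)"
proof -
  have ad: "R \<in> adjointable E" using assms by (simp add: is_inv_sqrt_def)
  then have [simp]: "R x \<in> carrier E" if "x \<in> carrier E" for x
    using that by (auto simp: adjointable_def)
  show ?thesis
    using assms adjointable_image[OF ad] by (simp add: is_inv_sqrt_def)
qed

text \<open>Oddness of \<open>D\<close> makes the grading preserve \<open>Dom D\<close>, so that \<open>D\<close> is applied only on its
  domain when the graded commutator is carried over.\<close>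

lemma Lip_image:
  assumes odd: "odd_operator E D" and "T \<in> Lip E D"
  shows "transport T \<in> Lip F D'"
proof -
  have ad: "T \<in> adjointable E" and TD: "T ` Dom D \<subseteq> Dom D" using assms(2) by (simp_all add: Lip_def)
  have T [simp]: "T x \<in> carrier E" if "x \<in> carrier E" for x
    using that ad by (auto simp: adjointable_def)
  obtain C where C: "C \<in> adjointable E" "\<And>x. x \<in> Dom D \<Longrightarrow> C x = graded_commutator E D T x"
    using assms(2) by (auto simp: Lip_def)
  have e [simp]: "even_part E T x \<in> carrier E" "even_part F (transport T) (\<phi> x) = \<phi> (even_part E T x)"
    "odd_part E T x \<in> carrier E" "odd_part F (transport T) (\<phi> x) = \<phi> (odd_part E T x)"
    if "x \<in> carrier E" for x
    using that by (simp_all add: even_part_def odd_part_def)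
  have "graded_commutator F D' (transport T) (\<phi> x) = \<phi> (graded_commutator E D T x)" if x: "x \<in> Dom D" for x
  proof -
    have "even_part E T x \<in> Dom D" "odd_part E T x \<in> Dom D"
      using odd by (auto intro!: even_odd_part_Dom[OF D _ TD x] simp: odd_operator_def)
    then show ?thesis using x by (simp add: graded_commutator_def)
  qed
  then have "\<forall>u\<in>Dom D'. transport C u = graded_commutator F D' (transport T) u"
    using C(2) by simp
  moreover have "transport T ` Dom D' \<subseteq> Dom D'" using TD by auto
  ultimately show ?thesis
    unfolding Lip_def using adjointable_image ad C(1) by blast
qed

lemma Lip0_image:
  assumes odd: "odd_operator E D" and T: "T \<in> Lip0 E D"
  shows "transport T \<in> Lip0 F D'"
proof -
  obtain R where R: "is_inv_sqrt E D R" "T \<circ> R \<in> compact_operators E" "adj E T \<circ> R \<in> compact_operators E"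
    using T by (auto simp: Lip0_def)
  have L: "T \<in> Lip E D" using T by (simp add: Lip0_def)
  then have ad: "T \<in> adjointable E" by (simp add: Lip_def)
  have Rc: "R x \<in> carrier E" if "x \<in> carrier E" for x
    using R(1) that by (auto simp: is_inv_sqrt_def adjointable_def)
  have "transport T \<circ> transport R \<in> compact_operators F"
    using compact_image[OF R(2)] unfolding compact_operators_def
    by (rule op_closure_cong) (auto simp: Rc)
  moreover have "adj F (transport T) \<circ> transport R \<in> compact_operators F"
    using compact_image[OF R(3)] unfolding compact_operators_def
    by (rule op_closure_cong) (auto simp: Rc adj_image[OF ad])
  ultimately show ?thesis
    unfolding Lip0_def using Lip_image[OF odd L] is_inv_sqrt_image[OF R(1)] by blast
qed

end

end

theorem unbounded_cycle_image:
  assumes cycle: "unbounded_cycle (\<pi>, E, D)" and inj: "inj_on \<phi> (carrier E)"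
  shows "unbounded_cycle (\<lambda>a. conjugate \<phi> E (\<pi> a), module_image \<phi> E, operator_image \<phi> E D)"
proof -
  have gr: "graded_hilbert_module E" using cycle by simp
  interpret graded_hilbert_image E \<phi>
    using gr graded_hilbert_module_pre_hilbert[OF gr] inj
    by (simp add: graded_hilbert_image_def graded_hilbert_image_axioms_def pre_hilbert_image_def
      pre_hilbert_image_axioms_def)
  have D: "densely_defined_operator E D" using cycle by (simp add: regular_def)
  have "transport (\<pi> a) \<in> op_closure F (Lip0 F (operator_image \<phi> E D))" for a
  proof (rule op_closure_image)
    show "\<pi> a \<in> op_closure E (Lip0 E D)" using cycle by auto
    show "Lip0 E D \<subseteq> carrier E \<rightarrow> carrier E" by (auto simp: Lip0_def Lip_def adjointable_def)
    show "transport S \<in> Lip0 F (operator_image \<phi> E D)" if "S \<in> Lip0 E D" for S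
      using cycle by (intro Lip0_image[OF D _ that]) simp
  qed
  then show ?thesis
    using cycle D graded_hilbert_module_image countably_generated_image graded_representation_image
      regular_image self_adjoint_image odd_operator_image by auto
qed

lemma cycle_equiv_image:
  assumes "unbounded_cycle (\<pi>, E, D)" and inj: "inj_on \<phi> (carrier E)"
  shows "cycle_equiv (\<pi>, E, D) (\<lambda>a. conjugate \<phi> E (\<pi> a), module_image \<phi> E, operator_image \<phi> E D)"
proof -
  have gr: "graded_hilbert_module E" using assms by simp
  interpret graded_hilbert_image E \<phi>
    using gr graded_hilbert_module_pre_hilbert[OF gr] inj
    by (simp add: graded_hilbert_image_def graded_hilbert_image_axioms_def pre_hilbert_image_def
      pre_hilbert_image_axioms_def)
  have D: "densely_defined_operator E D" using assms by (simp add: regular_def)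
  show ?thesis
    using inj by (simp del: image_simps(9) add: bij_betw_def Dom_closed[OF D])
      (intro exI[of _ \<phi>], simp add: Dom_closed[OF D])
qed

section \<open>Embedding a countably generated module into sequences\<close>

text \<open>The inner products with a generating sequence determine those with all finite combinations
  \<open>\<Sum>i. g\<^sub>i b\<^sub>i\<close>, which are dense, and hence the element.\<close>

lemma (in pre_hilbert) inner_product_embedding:
  assumes "countably_generated E"
  obtains \<phi> :: "'e \<Rightarrow> nat \<Rightarrow> 'b" where "inj_on \<phi> (carrier E)"
proof -
  obtain G where G: "G \<subseteq> carrier E" "countable G"
    and dense: "hdense E {(\<Oplus>i\<in>{..<n}. act E (g i) (b i)) | (n::nat) g b. \<forall>i<n. g i \<in> G}"
    using assms unfolding countably_generated_def by blast
  \<comment> \<open>\<open>\<zero>\<close> is added so that the enumerated set is nonempty.\<close>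
  define \<phi> where "\<phi> x n = hinner E x (from_nat_into (insert \<zero> G) n)" for x and n :: nat
  have "inj_on \<phi> (carrier E)"
  proof (rule inj_onI)
    fix x y assume xy: "x \<in> carrier E" "y \<in> carrier E" and eq: "\<phi> x = \<phi> y"
    have g: "hinner E x g = hinner E y g" if g: "g \<in> G" for g
    proof -
      obtain n where "from_nat_into (insert \<zero> G) n = g"
        using from_nat_into_surj[of "insert \<zero> G" g] G g by auto
      then show ?thesis using fun_cong[OF eq, of n] by (simp add: \<phi>_def)
    qed
    have sum: "hinner E x (\<Oplus>i\<in>{..<n}. act E (g i) (b i)) = hinner E y (\<Oplus>i\<in>{..<n}. act E (g i) (b i))"
      if "\<forall>i<n. g i \<in> G" for n :: nat and g' b and g :: "nat \<Rightarrow> 'e"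
      using that
    proof (induction n)
      case (Suc n)
      then have c: "g i \<in> carrier E" if "i < Suc n" for i using that G(1) by blast
      then have "(\<Oplus>i\<in>{..<n}. act E (g i) (b i)) \<in> carrier E" by (intro finsum_closed) auto
      then show ?case
        using Suc c xy by (simp add: finsum_Suc_lessThan hinner_add_right hinner_act_right g)
    qed (use xy in simp)
    show "x = y"
    proof (rule hinner_eqI_dense[OF xy dense])
      fix s assume s: "s \<in> {(\<Oplus>i\<in>{..<n}. act E (g i) (b i)) | (n::nat) g b. \<forall>i<n. g i \<in> G}"
      then have sc: "s \<in> carrier E" using dense by (auto simp: hdense_def)
      have "hinner E x s = hinner E y s" using s sum by auto
      then show "hinner E s x = hinner E s y"
        using star_hinner[OF xy(1) sc] star_hinner[OF xy(2) sc] by simp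
    qed
  qed
  then show thesis by (rule that)
qed

section \<open>Unitary equivalence and the semigroup of classes\<close>

lemma cycle_equiv_trans:
  assumes "cycle_equiv x y" "cycle_equiv y z"
  shows "cycle_equiv x z"
proof -
  obtain \<pi> E D where x: "x = (\<pi>, E, D)" by (cases x)
  obtain \<rho> F D' where y: "y = (\<rho>, F, D')" by (cases y)
  obtain \<sigma> G D'' where z: "z = (\<sigma>, G, D'')" by (cases z)
  obtain U where U: "bij_betw U (carrier E) (carrier F)"
    "\<forall>x\<in>carrier E. \<forall>y\<in>carrier E. U (x \<oplus>\<^bsub>E\<^esub> y) = U x \<oplus>\<^bsub>F\<^esub> U y"
    "\<forall>x\<in>carrier E. \<forall>c. U (c \<odot>\<^bsub>E\<^esub> x) = c \<odot>\<^bsub>F\<^esub> U x"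
    "\<forall>x\<in>carrier E. \<forall>b. U (act E x b) = act F (U x) b"
    "\<forall>x\<in>carrier E. \<forall>y\<in>carrier E. hinner F (U x) (U y) = hinner E x y"
    "\<forall>x\<in>carrier E. U (hgrade E x) = hgrade F (U x)"
    "\<forall>a. \<forall>x\<in>carrier E. U (\<pi> a x) = \<rho> a (U x)"
    "U ` Dom D = Dom D'" "\<forall>x\<in>Dom D. U (app D x) = app D' (U x)"
    using assms(1) by (auto simp: x y)
  obtain V where V: "bij_betw V (carrier F) (carrier G)"
    "\<forall>x\<in>carrier F. \<forall>y\<in>carrier F. V (x \<oplus>\<^bsub>F\<^esub> y) = V x \<oplus>\<^bsub>G\<^esub> V y"
    "\<forall>x\<in>carrier F. \<forall>c. V (c \<odot>\<^bsub>F\<^esub> x) = c \<odot>\<^bsub>G\<^esub> V x"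
    "\<forall>x\<in>carrier F. \<forall>b. V (act F x b) = act G (V x) b"
    "\<forall>x\<in>carrier F. \<forall>y\<in>carrier F. hinner G (V x) (V y) = hinner F x y"
    "\<forall>x\<in>carrier F. V (hgrade F x) = hgrade G (V x)"
    "\<forall>a. \<forall>x\<in>carrier F. V (\<rho> a x) = \<sigma> a (V x)"
    "V ` Dom D' = Dom D''" "\<forall>x\<in>Dom D'. V (app D' x) = app D'' (V x)"
    using assms(2) by (auto simp: y z)
  have UF: "U x \<in> carrier F" if "x \<in> carrier E" for x
    using U(1) that by (rule bij_betwE[THEN bspec])
  have "bij_betw (V \<circ> U) (carrier E) (carrier G)" using U(1) V(1) by (rule bij_betw_trans)
  moreover have "(V \<circ> U) ` Dom D = Dom D''" using U(8) V(8) by (simp only: image_comp[symmetric])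
  moreover have "\<forall>x\<in>Dom D. V (U (app D x)) = app D'' (V (U x))"
    using U(8,9) V(9) by auto
  ultimately show ?thesis
    unfolding x z cycle_equiv.simps
    by (intro exI[of _ "V \<circ> U"]) (simp add: UF U(2-7) V(2-7))
qed

text \<open>As \<open>x\<close> is a cycle, its operations stay in the carrier, the domain lies in the carrier,
  and there the unitary can be cancelled.\<close>

lemma cycle_equiv_sym:
  assumes "unbounded_cycle x" "cycle_equiv x y"
  shows "cycle_equiv y x"
proof -
  obtain \<pi> E D where x: "x = (\<pi>, E, D)" by (cases x)
  obtain \<rho> F D' where y: "y = (\<rho>, F, D')" by (cases y)
  obtain U where U: "bij_betw U (carrier E) (carrier F)"
    "\<forall>x\<in>carrier E. \<forall>y\<in>carrier E. U (x \<oplus>\<^bsub>E\<^esub> y) = U x \<oplus>\<^bsub>F\<^esub> U y"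
    "\<forall>x\<in>carrier E. \<forall>c. U (c \<odot>\<^bsub>E\<^esub> x) = c \<odot>\<^bsub>F\<^esub> U x"
    "\<forall>x\<in>carrier E. \<forall>b. U (act E x b) = act F (U x) b"
    "\<forall>x\<in>carrier E. \<forall>y\<in>carrier E. hinner F (U x) (U y) = hinner E x y"
    "\<forall>x\<in>carrier E. U (hgrade E x) = hgrade F (U x)"
    "\<forall>a. \<forall>x\<in>carrier E. U (\<pi> a x) = \<rho> a (U x)"
    "U ` Dom D = Dom D'" "\<forall>x\<in>Dom D. U (app D x) = app D' (U x)"
    using assms(2) by (auto simp: x y)
  have gr: "graded_hilbert_module E" using assms(1) by (simp add: x)
  interpret pre_hilbert E by (rule graded_hilbert_module_pre_hilbert[OF gr])
  have D: "densely_defined_operator E D" using assms(1) by (simp add: x regular_def)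
  have \<pi>: "\<pi> a u \<in> carrier E" if "u \<in> carrier E" for a u
    using assms(1) that by (auto simp: x graded_representation_def adjointable_def)
  define V where "V = inv_into (carrier E) U"
  have VU: "V (U u) = u" if "u \<in> carrier E" for u
    using U(1) that by (simp add: V_def bij_betw_inv_into_left)
  have F: "carrier F = U ` carrier E" using U(1) by (simp add: bij_betw_def)
  have "bij_betw V (carrier F) (carrier E)"
    unfolding V_def using U(1) by (rule bij_betw_inv_into)
  moreover have "V ` Dom D' = Dom D"
    unfolding U(8)[symmetric] image_image using VU Dom_closed[OF D] by (simp cong: image_cong)
  moreover have "V u \<in> carrier E" if "u \<in> carrier F" for u using that VU by (auto simp: F)
  moreover have "\<forall>u\<in>carrier F. \<forall>v\<in>carrier F. V (u \<oplus>\<^bsub>F\<^esub> v) = V u \<oplus>\<^bsub>E\<^esub> V v"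
    by (auto simp: F VU U(2)[rule_format, symmetric])
  moreover have "\<forall>u\<in>carrier F. \<forall>c. V (c \<odot>\<^bsub>F\<^esub> u) = c \<odot>\<^bsub>E\<^esub> V u"
    by (auto simp: F VU U(3)[rule_format, symmetric])
  moreover have "\<forall>u\<in>carrier F. \<forall>b. V (act F u b) = act E (V u) b"
    by (auto simp: F VU U(4)[rule_format, symmetric])
  moreover have "\<forall>u\<in>carrier F. \<forall>v\<in>carrier F. hinner E (V u) (V v) = hinner F u v"
    using U(5) by (auto simp: F VU)
  moreover have "\<forall>u\<in>carrier F. V (hgrade F u) = hgrade E (V u)"
    by (auto simp: F VU hgrade_closed[OF gr] U(6)[rule_format, symmetric])
  moreover have "\<forall>a. \<forall>u\<in>carrier F. V (\<rho> a u) = \<pi> a (V u)"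
    by (auto simp: F VU \<pi> U(7)[rule_format, symmetric])
  moreover have "\<forall>u\<in>Dom D'. V (app D' u) = app D (V u)"
    unfolding U(8)[symmetric]
    by (auto simp: VU Dom_closed[OF D] app_closed[OF D] U(9)[rule_format, symmetric])
  ultimately show ?thesis
    unfolding x y cycle_equiv.simps by (intro exI[of _ V]) simp
qed

lemma cycle_equiv_sum:
  assumes "cycle_equiv x x'" "cycle_equiv y y'"
  shows "cycle_equiv (cycle_sum x y) (cycle_sum x' y')"
proof -
  obtain \<pi> E D where x: "x = (\<pi>, E, D)" by (cases x)
  obtain \<rho> F C where y: "y = (\<rho>, F, C)" by (cases y)
  obtain \<pi>' E' D' where x': "x' = (\<pi>', E', D')" by (cases x')
  obtain \<rho>' F' C' where y': "y' = (\<rho>', F', C')" by (cases y')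
  obtain U where U: "bij_betw U (carrier E) (carrier E')"
    "\<forall>x\<in>carrier E. \<forall>y\<in>carrier E. U (x \<oplus>\<^bsub>E\<^esub> y) = U x \<oplus>\<^bsub>E'\<^esub> U y"
    "\<forall>x\<in>carrier E. \<forall>c. U (c \<odot>\<^bsub>E\<^esub> x) = c \<odot>\<^bsub>E'\<^esub> U x"
    "\<forall>x\<in>carrier E. \<forall>b. U (act E x b) = act E' (U x) b"
    "\<forall>x\<in>carrier E. \<forall>y\<in>carrier E. hinner E' (U x) (U y) = hinner E x y"
    "\<forall>x\<in>carrier E. U (hgrade E x) = hgrade E' (U x)"
    "\<forall>a. \<forall>x\<in>carrier E. U (\<pi> a x) = \<pi>' a (U x)"
    "U ` Dom D = Dom D'" "\<forall>x\<in>Dom D. U (app D x) = app D' (U x)"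
    using assms(1) by (auto simp: x x')
  obtain V where V: "bij_betw V (carrier F) (carrier F')"
    "\<forall>x\<in>carrier F. \<forall>y\<in>carrier F. V (x \<oplus>\<^bsub>F\<^esub> y) = V x \<oplus>\<^bsub>F'\<^esub> V y"
    "\<forall>x\<in>carrier F. \<forall>c. V (c \<odot>\<^bsub>F\<^esub> x) = c \<odot>\<^bsub>F'\<^esub> V x"
    "\<forall>x\<in>carrier F. \<forall>b. V (act F x b) = act F' (V x) b"
    "\<forall>x\<in>carrier F. \<forall>y\<in>carrier F. hinner F' (V x) (V y) = hinner F x y"
    "\<forall>x\<in>carrier F. V (hgrade F x) = hgrade F' (V x)"
    "\<forall>a. \<forall>x\<in>carrier F. V (\<rho> a x) = \<rho>' a (V x)"
    "V ` Dom C = Dom C'" "\<forall>x\<in>Dom C. V (app C x) = app C' (V x)"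
    using assms(2) by (auto simp: y y')
  have "bij_betw (map_prod U V) (carrier E \<times> carrier F) (carrier E' \<times> carrier F')"
    using U(1) V(1) by (auto simp: bij_betw_def intro!: map_prod_inj_on map_prod_surj_on)
  moreover have "map_prod U V ` (Dom D \<times> Dom C) = Dom D' \<times> Dom C'"
    using U(8) V(8) by (rule map_prod_surj_on)
  ultimately show ?thesis
    unfolding x y x' y' cycle_sum.simps cycle_equiv.simps
    using U(2-7,9) V(2-7,9)
    by (intro exI[of _ "map_prod U V"]) (simp add: module_sum_def rep_sum_def operator_sum_def)
qed

lemma cycle_equiv_sum_assoc:
  "cycle_equiv (cycle_sum (cycle_sum x y) z) (cycle_sum x (cycle_sum y z))"
proof -
  obtain \<pi> E D where x: "x = (\<pi>, E, D)" by (cases x)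
  obtain \<rho> F C where y: "y = (\<rho>, F, C)" by (cases y)
  obtain \<sigma> G B where z: "z = (\<sigma>, G, B)" by (cases z)
  let ?U = "\<lambda>((u, v), w). (u, v, w)"
  have "bij_betw ?U ((carrier E \<times> carrier F) \<times> carrier G) (carrier E \<times> carrier F \<times> carrier G)"
    by (rule bij_betw_byWitness[where f' = "\<lambda>(u, v, w). ((u, v), w)"]) auto
  moreover have "?U ` ((Dom D \<times> Dom C) \<times> Dom B) = Dom D \<times> Dom C \<times> Dom B"
    by force
  ultimately show ?thesis
    unfolding x y z cycle_sum.simps cycle_equiv.simps
    by (intro exI[of _ ?U]) (simp add: module_sum_def rep_sum_def operator_sum_def add.assoc)
qed

lemma cycle_class_eq:
  assumes "unbounded_cycle x" "cycle_equiv x y"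
  shows "cycle_class x = cycle_class y"
  using cycle_equiv_trans[OF _ assms(2)] cycle_equiv_trans[OF _ cycle_equiv_sym[OF assms]]
  by (auto simp: cycle_class_def)

lemma unbounded_cycle_cycle_sum:
  "\<lbrakk>unbounded_cycle x; unbounded_cycle y\<rbrakk> \<Longrightarrow> unbounded_cycle (cycle_sum x y)"
  by (cases x; cases y) (simp only: cycle_sum.simps unbounded_cycle_sum)

lemma cycle_class_nonempty:
  fixes x :: "('a::graded_cstar_algebra, 'b::graded_cstar_algebra, 'e) cycle"
  assumes x: "unbounded_cycle x"
  obtains z where "z \<in> cycle_class x"
proof -
  obtain \<pi> E D where xE: "x = (\<pi>, E, D)" by (cases x)
  have gr: "graded_hilbert_module E" "countably_generated E" using x by (simp_all add: xE)
  interpret pre_hilbert E by (rule graded_hilbert_module_pre_hilbert[OF gr(1)])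
  obtain \<phi> :: "'e \<Rightarrow> nat \<Rightarrow> 'b" where \<phi>: "inj_on \<phi> (carrier E)"
    using inner_product_embedding[OF gr(2)] .
  note im = unbounded_cycle_image[OF x[unfolded xE] \<phi>] cycle_equiv_image[OF x[unfolded xE] \<phi>]
  show thesis
    using im(1) cycle_equiv_sym[OF x[unfolded xE] im(2)]
    by (intro that) (simp add: cycle_class_def xE del: unbounded_cycle.simps cycle_equiv.simps)
qed

lemma cycle_class_in_Psi1:
  assumes x: "unbounded_cycle x"
  shows "cycle_class x \<in> Psi1"
proof -
  obtain z where "z \<in> cycle_class x" using cycle_class_nonempty[OF x] .
  then have z: "unbounded_cycle z" "cycle_equiv z x" by (simp_all add: cycle_class_def)
  have "cycle_class z = cycle_class x" by (rule cycle_class_eq[OF z])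
  then show ?thesis using z(1) unfolding Psi1_def by blast
qed

text \<open>All the classes in the union that defines \<open>class_sum\<close> coincide, and the union is not empty because the
  classes of \<open>x\<close> and \<open>y\<close> are not.\<close>

lemma class_sum_cycle_class:
  assumes x: "unbounded_cycle x" and y: "unbounded_cycle y"
  shows "class_sum (cycle_class x) (cycle_class y) = cycle_class (cycle_sum x y)"
proof -
  have *: "cycle_class (cycle_sum x' y') = cycle_class (cycle_sum x y)"
    if "x' \<in> cycle_class x" "y' \<in> cycle_class y" for x' y'
    using that by (intro cycle_class_eq unbounded_cycle_cycle_sum cycle_equiv_sum) (simp_all add: cycle_class_def)
  obtain x' y' where "x' \<in> cycle_class x" "y' \<in> cycle_class y"
    using cycle_class_nonempty[OF x] cycle_class_nonempty[OF y] by metis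
  then show ?thesis unfolding class_sum_def using * by blast
qed

lemma is_semigroup_Psi1:
  "is_semigroup (Psi1 :: ('a::graded_cstar_algebra, 'b::graded_cstar_algebra, nat \<Rightarrow> 'b) cycle set set) class_sum"
  unfolding is_semigroup_def
proof (intro conjI ballI)
  fix P Q R :: "('a, 'b, nat \<Rightarrow> 'b) cycle set"
  assume "P \<in> Psi1" "Q \<in> Psi1"
  then obtain x y :: "('a, 'b, nat \<Rightarrow> 'b) cycle" where
    xy: "unbounded_cycle x" "unbounded_cycle y" "P = cycle_class x" "Q = cycle_class y"
    unfolding Psi1_def by blast
  note sum = unbounded_cycle_cycle_sum
  show "class_sum P Q \<in> Psi1"
    using xy by (simp add: class_sum_cycle_class cycle_class_in_Psi1 sum)
  assume "R \<in> Psi1"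
  then obtain z :: "('a, 'b, nat \<Rightarrow> 'b) cycle" where z: "unbounded_cycle z" "R = cycle_class z"
    unfolding Psi1_def by blast
  have "cycle_class (cycle_sum (cycle_sum x y) z) = cycle_class (cycle_sum x (cycle_sum y z))"
    using xy z by (intro cycle_class_eq sum cycle_equiv_sum_assoc)
  then show "class_sum (class_sum P Q) R = class_sum P (class_sum Q R)"
    using xy z by (simp add: class_sum_cycle_class sum)
qed

theorem lemma1p4:
  assumes "sigma_unital TYPE('a::graded_cstar_algebra)"
    and "sigma_unital TYPE('b::graded_cstar_algebra)"
  shows
    "(\<forall>(\<pi>\<^sub>0 :: 'a \<Rightarrow> 'e0 \<Rightarrow> 'e0) (E\<^sub>0 :: ('b, 'e0) hilbert_module) D\<^sub>0
       (\<pi>\<^sub>1 :: 'a \<Rightarrow> 'e1 \<Rightarrow> 'e1) (E\<^sub>1 :: ('b, 'e1) hilbert_module) D\<^sub>1.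
       unbounded_cycle (\<pi>\<^sub>0, E\<^sub>0, D\<^sub>0) \<longrightarrow> unbounded_cycle (\<pi>\<^sub>1, E\<^sub>1, D\<^sub>1) \<longrightarrow>
       unbounded_cycle (rep_sum \<pi>\<^sub>0 \<pi>\<^sub>1, module_sum E\<^sub>0 E\<^sub>1, operator_sum D\<^sub>0 D\<^sub>1)) \<and>
     (\<forall>(x :: ('a, 'b, 'e0) cycle) (y :: ('a, 'b, 'e1) cycle).
       unbounded_cycle x \<longrightarrow> unbounded_cycle y \<longrightarrow>
       cycle_class x \<in> Psi1 \<and> cycle_class y \<in> Psi1 \<and>
       class_sum (cycle_class x) (cycle_class y) = cycle_class (cycle_sum x y)) \<and>
     is_semigroup (Psi1 :: ('a, 'b, nat \<Rightarrow> 'b) cycle set set) class_sum"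
  by (intro conjI allI impI)
    (assumption | rule unbounded_cycle_sum cycle_class_in_Psi1 class_sum_cycle_class is_semigroup_Psi1)+

end
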